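(* Let $\Sigma_0$ be a closed hyperbolic $m$-manifold. For any nontrivial homotopy class $\varphi$ of maps $\Sigma_0\to\mathbb R/\mathbb Z$, the stretch lamination $\lambda_0(\varphi)$ is chain-recurrent.
   Context: A representative $\tau_0$ of $\varphi$ is tight if its Lipschitz constant equals $\sup_\gamma\deg(\varphi|_\gamma)/\ell(\gamma)$, the supremum over closed curves $\gamma\subset\Sigma_0$, where $\ell$ is hyperbolic length (this is the minimal Lipschitz constant in $\varphi$). $\mathrm{Stretch}(\tau_0)$ is the set of points whose local Lipschitz constant is the global Lipschitz constant. The stretch lamination $\lambda_0(\varphi)$ is the intersection of $\mathrm{Stretch}(\tau_0)$ over all tight representatives $\tau_0$ of $\varphi$. It is known (Guéritaud–Kassel) that $\lambda_0(\varphi)$ is a nonempty geodesic lamination and that there is a tight representative with $\mathrm{Stretch}(\tau_0)=\lambda_0(\varphi)$. It is oriented by the direction in which $\tau_0$ increases along leaves. Chain recurrence. Let $\mu$ be an oriented geodesic lamination in a hyperbolic manifold and $x,y\in\mu$. For $b,\varepsilon>0$, a $(b,\varepsilon)$-chain from $x$ to $y$ is a sequence of directed subsegments $\alpha_0,\dots,\alpha_k$ of leaves of $\mu$, each of length at least $b$, such that $\alpha_0$ begins at $x$, $\alpha_k$ terminates at $y$, and for each $i<k$ the terminal point of the tangent lift $T^1\alpha_i$ in the unit tangent bundle is within $\varepsilon$ of the initial point of $T^1\alpha_{i+1}$. A point $x\in\mu$ is chain-recurrent if there exists $b>0$ such that for every $\varepsilon>0$ there is a $(b,\varepsilon)$-chain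 from $x$ to itself. $\mu$ is chain-recurrent if all its points are. *)

theory Defs
  imports "HOL-Analysis.Analysis"
begin

section \<open>The circle \<open>\<real>/\<int>\<close>\<close>

quotient_type circle = real / "\<lambda>x y::real. x - y \<in> \<int>"
proof (rule equivpI)
  show "reflp (\<lambda>x y::real. x - y \<in> \<int>)"
    by (simp add: reflp_def)
  show "symp (\<lambda>x y::real. x - y \<in> \<int>)"
    by (metis (mono_tags, lifting) Ints_minus minus_diff_eq sympI)
  show "transp (\<lambda>x y::real. x - y \<in> \<int>)"
    by (rule transpI) (metis Ints_add diff_add_cancel add_diff_eq)
qed

lift_definition circle_of :: "real \<Rightarrow> circle" is "\<lambda>x. x" .

lemma round_dist_le: "\<bar>x - of_int (round x)\<bar> \<le> \<bar>x - of_int n\<bar>" for x :: real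
  using round_diff_minimal[of x n] by simp

instantiation circle :: metric_space
begin

text \<open>The quotient metric: the distance from \<open>x - y\<close> to the nearest integer.\<close>

lift_definition dist_circle :: "circle \<Rightarrow> circle \<Rightarrow> real"
  is "\<lambda>x y. \<bar>(x - y) - of_int (round (x - y))\<bar>"
proof -
  fix x x' y y' :: real
  assume "x - x' \<in> \<int>" "y - y' \<in> \<int>"
  then obtain k l :: int where kl: "x = x' + of_int k" "y = y' + of_int l"
    by (metis Ints_cases add.commute diff_add_cancel)
  have eq: "x - y = (x' - y') + of_int (k - l)"
    using kl by simp
  have "\<bar>(x - y) - of_int (round (x - y))\<bar> \<le> \<bar>(x - y) - of_int (round (x' - y') + (k - l))\<bar>"
    by (rule round_dist_le)
  moreover have "\<bar>(x' - y') - of_int (round (x' - y'))\<bar> \<le> \<bar>(x' - y') - of_int (round (x - y) - (k - l))\<bar>"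
    by (rule round_dist_le)
  ultimately show "\<bar>(x - y) - of_int (round (x - y))\<bar> = \<bar>(x' - y') - of_int (round (x' - y'))\<bar>"
    unfolding eq by (simp add: algebra_simps)
qed

definition uniformity_circle :: "(circle \<times> circle) filter"
  where "uniformity_circle = (INF e\<in>{0<..}. principal {(x, y). dist x y < e})"

definition open_circle :: "circle set \<Rightarrow> bool"
  where "open_circle U \<longleftrightarrow> (\<forall>x\<in>U. eventually (\<lambda>(x', y). x' = x \<longrightarrow> y \<in> U) uniformity)"

instance
proof
  show "uniformity = (INF e\<in>{0<..}. principal {(x::circle, y). dist x y < e})"
    by (rule uniformity_circle_def)
  show "open U \<longleftrightarrow> (\<forall>x\<in>U. eventually (\<lambda>(x', y). x' = x \<longrightarrow> y \<in> U) uniformity)"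
    for U :: "circle set"
    by (rule open_circle_def)
  show "dist x y = 0 \<longleftrightarrow> x = y" for x y :: circle
    by transfer (metis Ints_cases Ints_of_int abs_0 abs_eq_0 eq_iff_diff_eq_0 round_of_int)
  show "dist x y \<le> dist x z + dist y z" for x y z :: circle
  proof transfer
    fix x y z :: real
    have "\<bar>(x - y) - of_int (round (x - y))\<bar>
        \<le> \<bar>(x - y) - of_int (round (x - z) - round (y - z))\<bar>"
      by (rule round_dist_le)
    then show "\<bar>(x - y) - of_int (round (x - y))\<bar>
        \<le> \<bar>(x - z) - of_int (round (x - z))\<bar> + \<bar>(y - z) - of_int (round (y - z))\<bar>"
      by simp
  qed
qed

end


section \<open>Closed hyperbolic manifolds\<close>

text \<open>
  Hyperbolic space of dimension \<open>CARD('m)\<close> in the hyperboloid model: the point \<open>x\<close> stands for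
  \<open>(x, sqrt (1 + norm x ^ 2))\<close>, and \<open>cosh\<close> of the distance is minus the Lorentzian product.
\<close>

definition hyp_dist :: "real ^ 'm \<Rightarrow> real ^ 'm \<Rightarrow> real" where
  "hyp_dist x y = arcosh (sqrt (1 + (norm x)\<^sup>2) * sqrt (1 + (norm y)\<^sup>2) - x \<bullet> y)"

definition curve_length :: "(real \<Rightarrow> 'a::metric_space) \<Rightarrow> ereal" where
  "curve_length g =
     (SUP (n, t) \<in> {(n::nat, t::nat \<Rightarrow> real).
                      (\<forall>i\<le>n. t i \<in> {0..1}) \<and> (\<forall>i<n. t i \<le> t (Suc i))}.
        ereal (\<Sum>i<n. dist (g (t i)) (g (t (Suc i)))))"

text \<open>
  A closed hyperbolic manifold, with its Riemannian distance: a compact length space in which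
  every point has a ball isometric to a ball of the same radius in hyperbolic space.  The infimum
  of the empty set is \<open>\<infinity>\<close>, so the second condition includes (path-)connectedness.
\<close>

definition closed_hyperbolic_manifold :: "'m::finite itself \<Rightarrow> 'a::metric_space itself \<Rightarrow> bool" where
  "closed_hyperbolic_manifold _ _ \<longleftrightarrow>
     compact (UNIV :: 'a set) \<and>
     (\<forall>x y :: 'a. ereal (dist x y) =
        (INF g \<in> {g. path g \<and> pathstart g = x \<and> pathfinish g = y}. curve_length g)) \<and>
     (\<forall>p :: 'a. \<exists>r>0. \<exists>c :: 'a \<Rightarrow> real ^ 'm.
        (\<forall>x\<in>ball p r. \<forall>y\<in>ball p r. hyp_dist (c x) (c y) = dist x y) \<and>
        c ` ball p r = {z. hyp_dist (c p) z < r})"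


section \<open>Homotopy classes of circle-valued maps\<close>

definition homotopy_class :: "('a::topological_space \<Rightarrow> circle) set \<Rightarrow> bool" where
  "homotopy_class \<phi> \<longleftrightarrow>
     (\<exists>f. continuous_on UNIV f \<and> \<phi> = {g. homotopic_with_canon (\<lambda>_. True) UNIV UNIV f g})"

definition nontrivial_class :: "('a \<Rightarrow> circle) set \<Rightarrow> bool" where
  "nontrivial_class \<phi> \<longleftrightarrow> (\<forall>c. (\<lambda>_. c) \<notin> \<phi>)"

definition loop_degree :: "(real \<Rightarrow> circle) \<Rightarrow> int" where
  "loop_degree c =
     (THE n. \<exists>f. continuous_on {0..1} f \<and> (\<forall>t\<in>{0..1}. c t = circle_of (f t)) \<and>
                 f 1 - f 0 = of_int n)"

text \<open>All \<open>f \<in> \<phi>\<close> give the same degree along a closed curve.\<close>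

definition class_degree :: "('a \<Rightarrow> circle) set \<Rightarrow> (real \<Rightarrow> 'a) \<Rightarrow> int" where
  "class_degree \<phi> g = (THE n. \<forall>f\<in>\<phi>. loop_degree (f \<circ> g) = n)"


section \<open>Tight representatives and the stretch lamination\<close>

text \<open>The least Lipschitz constant on \<open>S\<close>; it is \<open>\<infinity>\<close> if there is none.\<close>

definition Lip_const :: "'a::metric_space set \<Rightarrow> ('a \<Rightarrow> 'b::metric_space) \<Rightarrow> ereal" where
  "Lip_const S f = (INF K \<in> {K. K-lipschitz_on S f}. ereal K)"

definition local_Lip_const :: "('a::metric_space \<Rightarrow> 'b::metric_space) \<Rightarrow> 'a \<Rightarrow> ereal" where
  "local_Lip_const f x = (INF r \<in> {0<..}. Lip_const (ball x r) f)"

definition stretch_set :: "('a::metric_space \<Rightarrow> 'b::metric_space) \<Rightarrow> 'a set" where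
  "stretch_set f = {x. local_Lip_const f x = Lip_const UNIV f}"

definition closed_curves :: "(real \<Rightarrow> 'a::metric_space) set" where
  "closed_curves =
     {g. path g \<and> pathfinish g = pathstart g \<and> 0 < curve_length g \<and> curve_length g < \<infinity>}"

definition tight :: "('a::metric_space \<Rightarrow> circle) set \<Rightarrow> ('a \<Rightarrow> circle) \<Rightarrow> bool" where
  "tight \<phi> \<tau> \<longleftrightarrow> \<tau> \<in> \<phi> \<and>
     Lip_const UNIV \<tau> =
       (SUP g \<in> closed_curves. ereal (of_int (class_degree \<phi> g)) / curve_length g)"

definition stretch_lamination :: "('a::metric_space \<Rightarrow> circle) set \<Rightarrow> 'a set" where
  "stretch_lamination \<phi> = (\<Inter>\<tau>\<in>{\<tau>. tight \<phi> \<tau>}. stretch_set \<tau>)"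

definition geodesic_line :: "(real \<Rightarrow> 'a::metric_space) \<Rightarrow> bool" where
  "geodesic_line g \<longleftrightarrow>
     (\<forall>t. \<exists>e>0. \<forall>s\<in>ball t e. \<forall>s'\<in>ball t e. dist (g s) (g s') = \<bar>s - s'\<bar>)"

text \<open>
  The oriented leaves of the stretch lamination, as unit-speed parametrizations.  A closed union
  of geodesics does not by itself say which geodesics contained in it are leaves; the leaves of
  the stretch lamination are those that tight maps stretch by exactly their Lipschitz constant.
  The sign of the slope \<open>Lip_const UNIV \<tau>\<close> fixes the orientation: \<open>\<tau>\<close> increases along \<open>g\<close>.
\<close>

definition stretch_leaves :: "('a::metric_space \<Rightarrow> circle) set \<Rightarrow> (real \<Rightarrow> 'a) set" where
  "stretch_leaves \<phi> =
     {g. geodesic_line g \<and> range g \<subseteq> stretch_lamination \<phi> \<and>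
         (\<forall>\<tau>. tight \<phi> \<tau> \<longrightarrow>
            (\<exists>a. \<forall>t. \<tau> (g t) = circle_of (a + real_of_ereal (Lip_const UNIV \<tau>) * t)))}"


section \<open>Chain recurrence\<close>

text \<open>
  A unit tangent vector \<open>v\<close> is encoded by the complete unit-speed geodesic with initial velocity
  \<open>v\<close>.  The following is then a metric on the unit tangent bundle inducing its usual topology; on
  a closed manifold any two such metrics are uniformly equivalent, so the choice does not affect
  chain recurrence.
\<close>

definition tangent_dist :: "(real \<Rightarrow> 'a::metric_space) \<Rightarrow> (real \<Rightarrow> 'a) \<Rightarrow> real" where
  "tangent_dist g h = (SUP s\<in>{0..1}. dist (g s) (h s))"

definition tangent_at :: "(real \<Rightarrow> 'a) \<Rightarrow> real \<Rightarrow> (real \<Rightarrow> 'a)" where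
  "tangent_at g t = (\<lambda>s. g (t + s))"

text \<open>
  An oriented lamination is given by its point set \<open>\<mu>\<close> and the set \<open>L\<close> of unit-speed
  parametrizations of its oriented leaves; the \<open>i\<close>-th segment of a chain is the restriction of
  \<open>\<gamma> i\<close> to \<open>{s i..t i}\<close>.
\<close>

definition leaf_chain ::
  "(real \<Rightarrow> 'a::metric_space) set \<Rightarrow> real \<Rightarrow> real \<Rightarrow> 'a \<Rightarrow> 'a \<Rightarrow> bool" where
  "leaf_chain L b \<epsilon> x y \<longleftrightarrow>
     (\<exists>(k::nat) \<gamma> s t.
        (\<forall>i\<le>k. \<gamma> i \<in> L \<and> b \<le> t i - s i) \<and>
        \<gamma> 0 (s 0) = x \<and> \<gamma> k (t k) = y \<and>
        (\<forall>i<k. tangent_dist (tangent_at (\<gamma> i) (t i)) (tangent_at (\<gamma> (Suc i)) (s (Suc i))) < \<epsilon>))"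

definition chain_recurrent_point :: "(real \<Rightarrow> 'a::metric_space) set \<Rightarrow> 'a \<Rightarrow> bool" where
  "chain_recurrent_point L x \<longleftrightarrow> (\<exists>b>0. \<forall>\<epsilon>>0. leaf_chain L b \<epsilon> x x)"

definition chain_recurrent :: "'a::metric_space set \<Rightarrow> (real \<Rightarrow> 'a) set \<Rightarrow> bool" where
  "chain_recurrent \<mu> L \<longleftrightarrow> (\<forall>x\<in>\<mu>. chain_recurrent_point L x)"

end

theory Submission
  imports Defs
begin

text \<open>
  The argument is that of Aubry--Mather theory.  Let \<open>K\<close> be the supremum of degree over length.  Fix a representative \<open>f\<close> and assign to a
  curve the cost \<open>K\<close> times its length minus the increment of \<open>f\<close> along it; closed curves have
  nonnegative cost, so the infimal cost \<open>S x y\<close> of curves from \<open>x\<close> to \<open>y\<close> is finite, and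
  \<open>f + S x\<close> and \<open>f - (\<lambda>y. S y x)\<close> are \<open>K\<close>-Lipschitz, hence tight.  If all closed curves through
  \<open>x\<close> that are not short have cost bounded away from 0, then near \<open>x\<close> these two maps differ from a
  constant by the cones \<open>K * dist x y\<close> and \<open>- K * dist x y\<close>, so their average is tight and constant
  near \<open>x\<close>, and \<open>x\<close> is not in the stretch lamination.  Therefore every point of the lamination lies
  on closed curves of length bounded below and of arbitrarily small cost.  Every tight map has slope
  nearly \<open>K\<close> along such a curve, so by compactness each piece of the curve is shadowed by a leaf.
  These leaf segments form the required chain.

  Curves are replaced by finite chains of points with small steps, and limits of curves by cluster
  points in the product topology on functions from the reals.
\<close>

section \<open>Circle-valued maps and their lifts\<close>

text \<open>The representative of \<open>y - x\<close> in [-1/2, 1/2). Summing it along fine chains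
  gives increments of real lifts without a lift being chosen.\<close>

lift_definition cdiff :: "circle \<Rightarrow> circle \<Rightarrow> real"
  is "\<lambda>x y. (y - x) - of_int (round (y - x))"
proof -
  fix x x' y y' :: real
  assume "x - x' \<in> \<int>" "y - y' \<in> \<int>"
  then obtain k l :: int where kl: "x = x' + of_int k" "y = y' + of_int l"
    by (metis Ints_cases add.commute diff_add_cancel)
  have "y - x = (y' - x') + of_int (l - k)"
    using kl by simp
  moreover have "round ((y' - x') + of_int (l - k)) = round (y' - x') + (l - k)"
    unfolding round_def by (metis floor_add_int add.assoc add.commute)
  ultimately show "(y - x) - of_int (round (y - x)) = (y' - x') - of_int (round (y' - x'))"
    by simp
qed

text \<open>The translation action of the reals. Homotopic maps are compared by a real rotation
  function rather than through a covering space.\<close>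

lift_definition rot :: "circle \<Rightarrow> real \<Rightarrow> circle" is "\<lambda>x r. x + r"
  by simp

lemma abs_cdiff: "\<bar>cdiff a b\<bar> = dist a b"
  unfolding dist_commute[of a b] by transfer simp

lemma rot_cdiff [simp]: "rot a (cdiff a b) = b"
  by transfer simp

lemma rot_0 [simp]: "rot a 0 = a"
  by transfer simp

lemma rot_rot [simp]: "rot (rot a r) s = rot a (r + s)"
  by transfer (simp add: algebra_simps)

lemma rot_circle_of [simp]: "rot (circle_of a) r = circle_of (a + r)"
  by transfer simp

lemma circle_of_surj: obtains a where "c = circle_of a"
proof -
  have "\<exists>a. c = circle_of a"
    by transfer (metis Ints_0 diff_self)
  then show ?thesis using that by blast
qed

lemma circle_of_eq_iff: "circle_of a = circle_of b \<longleftrightarrow> a - b \<in> \<int>"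
  by transfer simp

lemma cdiff_rot:
  assumes "\<bar>r\<bar> < 1/2"
  shows "cdiff a (rot a r) = r"
proof -
  have "round r = 0" using assms by (intro round_unique') simp
  then show ?thesis by transfer simp
qed

lemma cdiff_circle_of:
  assumes "\<bar>s - r\<bar> < 1/2"
  shows "cdiff (circle_of r) (circle_of s) = s - r"
  using cdiff_rot[OF assms, of "circle_of r"] by simp

lemma cdiff_self [simp]: "cdiff a a = 0"
  using cdiff_rot[of 0 a] by simp

lemma cdiff_add:
  assumes "\<bar>cdiff a b + cdiff b c\<bar> < 1/2"
  shows "cdiff a c = cdiff a b + cdiff b c"
  using cdiff_rot[OF assms, of a] by (metis rot_cdiff rot_rot)

lemma dist_rot_rot_le: "dist (rot a r) (rot b s) \<le> dist a b + \<bar>r - s\<bar>"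
proof transfer
  fix a r b s :: real
  have "\<bar>a + r - (b + s) - real_of_int (round (a + r - (b + s)))\<bar>
      \<le> \<bar>a + r - (b + s) - real_of_int (round (a - b))\<bar>"
    by (rule round_dist_le)
  then show "\<bar>a + r - (b + s) - real_of_int (round (a + r - (b + s)))\<bar>
       \<le> \<bar>a - b - real_of_int (round (a - b))\<bar> + \<bar>r - s\<bar>"
    by linarith
qed

lemma dist_rot:
  assumes "\<bar>r - s\<bar> < 1/2"
  shows "dist (rot a r) (rot a s) = \<bar>r - s\<bar>"
proof -
  have "cdiff (rot a r) (rot (rot a r) (s - r)) = s - r"
    using assms by (intro cdiff_rot) linarith
  then show ?thesis by (simp add: abs_cdiff[symmetric])
qed

lemma continuous_on_rot [continuous_intros]:
  assumes "continuous_on S f" "continuous_on S u"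
  shows "continuous_on S (\<lambda>x. rot (f x) (u x))"
  unfolding continuous_on_def tendsto_iff
proof (intro ballI allI impI)
  fix x and e :: real
  assume x: "x \<in> S" and e: "e > 0"
  have "\<forall>\<^sub>F y in at x within S. dist (f y) (f x) < e/2"
    "\<forall>\<^sub>F y in at x within S. dist (u y) (u x) < e/2"
    using assms x half_gt_zero[OF e] unfolding continuous_on_def tendsto_iff by blast+
  then show "\<forall>\<^sub>F y in at x within S. dist (rot (f y) (u y)) (rot (f x) (u x)) < e"
  proof eventually_elim
    case (elim y)
    then show ?case
      using dist_rot_rot_le[of "f y" "u y" "f x" "u x"] by (simp add: dist_real_def)
  qed
qed

lemma continuous_on_cdiff:
  assumes "continuous_on S f" "continuous_on S g" "\<And>x. x \<in> S \<Longrightarrow> dist (f x) (g x) < 1/2"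
  shows "continuous_on S (\<lambda>x. cdiff (f x) (g x))"
  unfolding continuous_on_def tendsto_iff
proof (intro ballI allI impI)
  fix x and e :: real
  assume x: "x \<in> S" and e: "e > 0"
  \<comment> \<open>Half the room left below 1/2, so that moving both arguments by less than
    \<open>e'\<close> keeps every sum in the range where \<open>cdiff\<close> is additive.\<close>
  define e' where "e' = min e (1/2 - dist (f x) (g x)) / 2"
  have e': "e' > 0" "2 * e' \<le> e" "2 * e' \<le> 1/2 - dist (f x) (g x)"
    using e assms(3)[OF x] by (auto simp: e'_def)
  have "\<forall>\<^sub>F y in at x within S. dist (f y) (f x) < e'"
    "\<forall>\<^sub>F y in at x within S. dist (g y) (g x) < e'"
    using assms(1,2) x e' unfolding continuous_on_def tendsto_iff by simp_all
  then show "\<forall>\<^sub>F y in at x within S. dist (cdiff (f y) (g y)) (cdiff (f x) (g x)) < e"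
  proof eventually_elim
    case (elim y)
    have *: "\<bar>cdiff (f y) (f x)\<bar> < e'" "\<bar>cdiff (g x) (g y)\<bar> < e'"
      "\<bar>cdiff (f x) (g x)\<bar> \<le> 1/2 - 2 * e'"
      using elim e' by (auto simp: abs_cdiff dist_commute)
    have 1: "cdiff (f x) (g y) = cdiff (f x) (g x) + cdiff (g x) (g y)"
      using * by (intro cdiff_add) linarith
    have "cdiff (f y) (g y) = cdiff (f y) (f x) + cdiff (f x) (g y)"
      using * 1 by (intro cdiff_add) linarith
    then show ?case
      using * 1 e' by (simp add: dist_real_def)
  qed
qed

section \<open>Homotopies, lifts and degrees\<close>

text \<open>By uniform continuity the homotopy splits into finitely many stages, in each of which
  every point moves by less than 1/2. There \<open>cdiff\<close> is continuous, and \<open>u\<close>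
  is the sum of the increments over the stages.\<close>

lemma homotopy_rotation:
  fixes h :: "real \<times> 'b::metric_space \<Rightarrow> circle"
  assumes X: "compact X" and h: "continuous_on ({0..1} \<times> X) h"
  obtains u where "continuous_on X u" "\<And>p. p \<in> X \<Longrightarrow> h (1, p) = rot (h (0, p)) (u p)"
proof -
  have "uniformly_continuous_on ({0..1} \<times> X) h"
    using h X by (intro compact_uniformly_continuous compact_Times) auto
  then obtain d where d: "d > 0" "\<And>z z'. z \<in> {0..1} \<times> X \<Longrightarrow> z' \<in> {0..1} \<times> X \<Longrightarrow>
      dist z' z < d \<Longrightarrow> dist (h z') (h z) < 1/2"
    unfolding uniformly_continuous_on_def by (metis half_gt_zero_iff zero_less_one)
  obtain N :: nat where N: "N > 0" "1 / real N < d"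
    using d(1) by (metis nat_approx_posE zero_less_Suc)
  define q where "q = (\<lambda>i p. h (real i / real N, p))"
  have dom: "(real i / real N, p) \<in> {0..1} \<times> X" if "i \<le> N" "p \<in> X" for i p
    using that N by auto
  have step: "dist (q i p) (q (Suc i) p) < 1/2" if "i < N" "p \<in> X" for i p
  proof -
    have "dist (real i / real N) (real (Suc i) / real N) = 1 / real N"
      using N by (simp add: dist_real_def field_simps)
    then have "dist (real i / real N, p) (real (Suc i) / real N, p) < d"
      using N by (simp add: dist_Pair_Pair)
    then show ?thesis
      unfolding q_def using that by (intro d(2) dom) auto
  qed
  have cont: "continuous_on X (q i)" if "i \<le> N" for i
    unfolding q_def
    by (rule continuous_on_compose2[OF h]) (use dom that in \<open>auto intro!: continuous_intros\<close>)
  define u where "u = (\<lambda>p. \<Sum>i<N. cdiff (q i p) (q (Suc i) p))"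
  have "continuous_on X u"
    unfolding u_def using step cont by (intro continuous_on_sum continuous_on_cdiff) auto
  moreover have "q n p = rot (q 0 p) (\<Sum>i<n. cdiff (q i p) (q (Suc i) p))" for n p
  proof (induction n)
    case (Suc n)
    have "rot (q 0 p) (\<Sum>i<Suc n. cdiff (q i p) (q (Suc i) p)) =
        rot (rot (q 0 p) (\<Sum>i<n. cdiff (q i p) (q (Suc i) p))) (cdiff (q n p) (q (Suc n) p))"
      by simp
    also have "\<dots> = q (Suc n) p"
      unfolding Suc.IH[symmetric] by simp
    finally show ?case ..
  qed simp
  from this[of N] have "h (1, p) = rot (h (0, p)) (u p)" for p
    using N by (simp add: q_def u_def)
  ultimately show ?thesis using that by blast
qed

lemma path_lift:
  fixes c :: "real \<Rightarrow> circle"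
  assumes "continuous_on {0..1} c"
  obtains F where "continuous_on {0..1} F" "\<And>t. t \<in> {0..1} \<Longrightarrow> c t = circle_of (F t)"
proof -
  \<comment> \<open>Shrinking the parameter to 0 is a homotopy from the constant \<open>c 0\<close>
    to \<open>c\<close>; its rotation function is a lift up to an additive constant.\<close>
  have "continuous_on ({0..1} \<times> {0..1}) (\<lambda>z. c (fst z * snd z))"
    by (rule continuous_on_compose2[OF assms])
      (auto intro!: continuous_intros mult_le_one)
  from homotopy_rotation[OF compact_Icc this]
  obtain u where u: "continuous_on {0..1} u" "\<And>p. p \<in> {0..1} \<Longrightarrow> c p = rot (c 0) (u p)"
    by auto
  obtain a where "c 0 = circle_of a" by (rule circle_of_surj)
  with u show ?thesis
    by (intro that[of "\<lambda>t. a + u t"]) (auto intro!: continuous_intros)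
qed

definition is_lift :: "(real \<Rightarrow> real) \<Rightarrow> (real \<Rightarrow> circle) \<Rightarrow> bool" where
  "is_lift F c \<longleftrightarrow> continuous_on {0..1} F \<and> (\<forall>t\<in>{0..1}. c t = circle_of (F t))"

text \<open>The difference of two lifts is continuous with integer values on an interval, hence
  constant.\<close>

lemma lift_unique:
  assumes "is_lift F c" "is_lift G c"
  shows "F 1 - F 0 = G 1 - G 0"
proof -
  have cont: "continuous_on {0..1} (\<lambda>t. F t - G t)"
    using assms by (auto simp: is_lift_def intro!: continuous_intros)
  have "F t - G t \<in> \<int>" if "t \<in> {0..1}" for t
    using assms that by (metis is_lift_def circle_of_eq_iff)
  then have "1 \<le> norm ((F s - G s) - (F t - G t))"
    if "s \<in> {0..1}" "t \<in> {0..1}" "F s - G s \<noteq> F t - G t" for s t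
    using that Ints_nonzero_abs_ge1[of "(F s - G s) - (F t - G t)"] by (simp add: Ints_diff)
  then have "(\<lambda>t. F t - G t) constant_on {0..1}"
    by (intro continuous_discrete_range_constant[OF _ cont] exI[of _ 1]) auto
  then obtain k where "\<And>t. t \<in> {0..1} \<Longrightarrow> F t - G t = k"
    unfolding constant_on_def by metis
  from this[of 0] this[of 1] show ?thesis by simp
qed

lemma loop_degree_eq:
  assumes "is_lift F c" "c 0 = c 1"
  shows "real_of_int (loop_degree c) = F 1 - F 0"
proof -
  have "circle_of (F 1) = circle_of (F 0)"
    using assms by (simp add: is_lift_def)
  then obtain n where n: "F 1 - F 0 = of_int n"
    unfolding circle_of_eq_iff by (elim Ints_cases)
  have "loop_degree c = n"
    unfolding loop_degree_def
  proof (rule the_equality)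
    show "\<exists>f. continuous_on {0..1} f \<and> (\<forall>t\<in>{0..1}. c t = circle_of (f t)) \<and> f 1 - f 0 = of_int n"
      using assms n by (auto simp: is_lift_def)
    fix m assume "\<exists>f. continuous_on {0..1} f \<and> (\<forall>t\<in>{0..1}. c t = circle_of (f t)) \<and> f 1 - f 0 = of_int m"
    then obtain f where "is_lift f c" "f 1 - f 0 = of_int m" by (auto simp: is_lift_def)
    with lift_unique[OF assms(1) this(1)] n show "m = n" by simp
  qed
  then show ?thesis using n by simp
qed

section \<open>Chains and curves in length spaces\<close>

text \<open>\<open>L\<close> is the length of the chain and \<open>C\<close> the sum of the weights \<open>w\<close> of its steps.\<close>
inductive chain :: "('a::metric_space \<Rightarrow> 'a \<Rightarrow> real) \<Rightarrow> real \<Rightarrow> 'a \<Rightarrow> 'a \<Rightarrow> real \<Rightarrow> real \<Rightarrow> bool"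
  for w \<mu> where
  refl: "chain w \<mu> x x 0 0"
| step: "chain w \<mu> x y L C \<Longrightarrow> dist y z < \<mu> \<Longrightarrow> chain w \<mu> x z (L + dist y z) (C + w y z)"

lemma chain_single: "dist x y < \<mu> \<Longrightarrow> chain w \<mu> x y (dist x y) (w x y)"
  using chain.step[OF chain.refl, of x y \<mu> w] by simp

lemma chain_dist_le: "chain w \<mu> x y L C \<Longrightarrow> dist x y \<le> L"
proof (induction rule: chain.induct)
  case (step x y L C z)
  then show ?case using dist_triangle[of x z y] by linarith
qed simp

lemma chain_trans:
  assumes "chain w \<mu> y z L' C'" "chain w \<mu> x y L C"
  shows "chain w \<mu> x z (L + L') (C + C')"
  using assms
proof (induction rule: chain.induct)
  case (step y y' L' C' z)
  then show ?case
    using chain.step[of w \<mu> x y' "L + L'" "C + C'" z] by (simp add: add.assoc)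
qed simp

lemma chain_mono: "chain w \<mu> x y L C \<Longrightarrow> \<mu> \<le> \<nu> \<Longrightarrow> chain w \<nu> x y L C"
  by (induction rule: chain.induct) (auto intro: chain.intros)

lemma chain_weight_coboundary:
  assumes "chain w \<mu> x y L C" "\<And>y z. dist y z < \<mu> \<Longrightarrow> w' y z = w y z + u z - u y"
  shows "chain w' \<mu> x y L (C + u y - u x)"
  using assms(1)
proof (induction rule: chain.induct)
  case (refl x)
  show ?case by (simp add: chain.refl)
next
  case (step x y L C z)
  have "C + w y z + u z - u x = C + u y - u x + w' y z"
    using assms(2)[OF step.hyps(2)] by simp
  then show ?case using chain.step[OF step.IH step.hyps(2)] by metis
qed

lemma chain_of_sequence:
  assumes "\<And>i. i < n \<Longrightarrow> dist (p i) (p (Suc i)) < \<mu>"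
  shows "chain w \<mu> (p 0) (p n) (\<Sum>i<n. dist (p i) (p (Suc i))) (\<Sum>i<n. w (p i) (p (Suc i)))"
  using assms by (induction n) (auto intro: chain.intros)

lemma sequence_of_chain:
  assumes "chain w \<mu> x y L C"
  shows "\<exists>n p. p 0 = x \<and> p n = y \<and> (\<forall>i<n. dist (p i) (p (Suc i)) < \<mu>) \<and>
    L = (\<Sum>i<n. dist (p i) (p (Suc i))) \<and> C = (\<Sum>i<n. w (p i) (p (Suc i)))"
  using assms
proof (induction rule: chain.induct)
  case (refl x)
  show ?case by (intro exI[of _ 0] exI[of _ "\<lambda>_. x"]) simp
next
  case (step x y L C z)
  then obtain n p where p: "p 0 = x" "p n = y" "\<forall>i<n. dist (p i) (p (Suc i)) < \<mu>"
    "L = (\<Sum>i<n. dist (p i) (p (Suc i)))" "C = (\<Sum>i<n. w (p i) (p (Suc i)))" by blast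
  define q where "q = p(Suc n := z)"
  have q: "q i = p i" if "i \<le> n" for i using that by (simp add: q_def)
  have "(\<Sum>i<n. dist (q i) (q (Suc i))) = L" "(\<Sum>i<n. w (q i) (q (Suc i))) = C"
    unfolding p by (auto intro!: sum.cong simp: q)
  then show ?case
    using p step.hyps(2)
    by (intro exI[of _ "Suc n"] exI[of _ q]) (auto simp: q less_Suc_eq, auto simp: q_def)
qed

section \<open>Local cocycles and short chains\<close>

text \<open>The additivity that increments of a local real lift satisfy, required on triangles with
  sides below \<open>\<delta>\<close>.\<close>

definition local_cocycle :: "('a::metric_space \<Rightarrow> 'a \<Rightarrow> real) \<Rightarrow> real \<Rightarrow> bool" where
  "local_cocycle w \<delta> \<longleftrightarrow> 0 < \<delta> \<and> (\<forall>x y z. dist x y < \<delta> \<longrightarrow> dist y z < \<delta> \<longrightarrow> dist x z < \<delta> \<longrightarrow>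
     w x z = w x y + w y z)"

lemma local_cocycle_refl: "local_cocycle w \<delta> \<Longrightarrow> w x x = 0"
  unfolding local_cocycle_def by (metis add_cancel_left_left dist_self)

lemma local_cocycle_sym:
  "local_cocycle w \<delta> \<Longrightarrow> dist x y < \<delta> \<Longrightarrow> w y x = - w x y"
  using local_cocycle_refl[of w \<delta> x] unfolding local_cocycle_def
  by (metis add.commute add_eq_0_iff dist_commute dist_self)

text \<open>Length bounds distance, so every intermediate point stays within \<open>\<delta>\<close>
  of the start and the cocycle identity absorbs the steps one at a time. A short chain thus cannot
  wind around the circle.\<close>

lemma short_chain:
  assumes "local_cocycle w \<delta>" "chain w \<mu> x y L C" "\<mu> \<le> \<delta>" "L < \<delta>"
  shows "C = w x y"
  using assms(2,4)
proof (induction rule: chain.induct)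
  case (refl x)
  then show ?case using local_cocycle_refl[OF assms(1)] by simp
next
  case (step x y L C z)
  have "dist x y \<le> L" "dist x z \<le> L + dist y z"
    using chain_dist_le step.hyps chain.step by blast+
  moreover have "L < \<delta>" using step.prems zero_le_dist[of y z] by linarith
  moreover have "C = w x y"
    using step.IH \<open>L < \<delta>\<close> by simp
  ultimately show ?case
    using assms(1,3) step unfolding local_cocycle_def
    by (metis le_less_trans less_le_trans)
qed

definition wt :: "('a::metric_space \<Rightarrow> circle) \<Rightarrow> 'a \<Rightarrow> 'a \<Rightarrow> real" where
  "wt f x y = cdiff (f x) (f y)"

text \<open>With the bound 1/4, two increments sum to less than 1/2 in absolute value, where
  \<open>cdiff\<close> is additive.\<close>

definition modulus :: "('a::metric_space \<Rightarrow> circle) \<Rightarrow> real \<Rightarrow> bool" where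
  "modulus f \<delta> \<longleftrightarrow> 0 < \<delta> \<and> (\<forall>x y. dist x y < \<delta> \<longrightarrow> dist (f x) (f y) < 1/4)"

lemma modulus_local_cocycle:
  assumes "modulus f \<delta>"
  shows "local_cocycle (wt f) \<delta>"
  unfolding local_cocycle_def wt_def
proof (intro conjI allI impI)
  fix x y z :: 'a assume "dist x y < \<delta>" "dist y z < \<delta>"
  then have "\<bar>cdiff (f x) (f y)\<bar> < 1/4" "\<bar>cdiff (f y) (f z)\<bar> < 1/4"
    using assms unfolding abs_cdiff modulus_def by blast+
  then show "cdiff (f x) (f z) = cdiff (f x) (f y) + cdiff (f y) (f z)"
    by (intro cdiff_add) linarith
qed (use assms in \<open>simp add: modulus_def\<close>)

section \<open>From paths to chains\<close>

lemma fine_subdivision: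
  fixes F :: "real \<Rightarrow> real"
  assumes "path g" "continuous_on {0..1} F" "0 < \<mu>" "0 < e"
  obtains N :: nat where "N > 0"
    "\<And>i. i < N \<Longrightarrow> dist (g (real i / N)) (g (real (Suc i) / N)) < \<mu>"
    "\<And>i. i < N \<Longrightarrow> \<bar>F (real (Suc i) / N) - F (real i / N)\<bar> < e"
proof -
  have "uniformly_continuous_on {0..1} g" "uniformly_continuous_on {0..1} F"
    using assms by (auto intro!: compact_uniformly_continuous simp: path_def)
  then obtain d1 d2 where d1: "d1 > 0" "\<And>s t. s \<in> {0..1} \<Longrightarrow> t \<in> {0..1} \<Longrightarrow> dist t s < d1 \<Longrightarrow> dist (g t) (g s) < \<mu>"
    and d2: "d2 > 0" "\<And>s t. s \<in> {0..1} \<Longrightarrow> t \<in> {0..1} \<Longrightarrow> dist t s < d2 \<Longrightarrow> dist (F t) (F s) < e"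
    using assms(3,4) unfolding uniformly_continuous_on_def by metis
  obtain N :: nat where N: "N > 0" "1 / real N < min d1 d2"
    using d1(1) d2(1) by (metis min_less_iff_conj nat_approx_posE zero_less_Suc)
  have dom: "real i / N \<in> {0..1}" if "i \<le> N" for i
    using that N by auto
  have "dist (real i / N) (real (Suc i) / N) = 1 / N" for i
    using N by (simp add: dist_real_def field_simps)
  then have d: "dist (real i / N) (real (Suc i) / N) < d1" "dist (real (Suc i) / N) (real i / N) < d2" for i
    using N by (simp_all add: dist_commute)
  show ?thesis
  proof (rule that[OF N(1)])
    fix i assume "i < N"
    then show "dist (g (real i / N)) (g (real (Suc i) / N)) < \<mu>"
      by (intro d1(2) dom d) auto
    from \<open>i < N\<close> have "dist (F (real (Suc i) / N)) (F (real i / N)) < e"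
      by (intro d2(2) dom d) auto
    then show "\<bar>F (real (Suc i) / N) - F (real i / N)\<bar> < e"
      by (simp add: dist_real_def)
  qed
qed

lemma subdivision_le_curve_length:
  assumes "N > 0"
  shows "ereal (\<Sum>i<N. dist (g (real i / N)) (g (real (Suc i) / N))) \<le> curve_length g"
  unfolding curve_length_def
  by (rule SUP_upper2[of "(N, \<lambda>i. real i / N)"]) (use assms in \<open>auto simp: divide_simps\<close>)

lemma path_fine_chain:
  assumes "path g" "0 < \<mu>"
  obtains L C where "chain w \<mu> (pathstart g) (pathfinish g) L C" "ereal L \<le> curve_length g"
proof -
  obtain N :: nat where N: "N > 0" "\<And>i. i < N \<Longrightarrow> dist (g (real i / N)) (g (real (Suc i) / N)) < \<mu>"
    by (rule fine_subdivision[OF assms(1), of "\<lambda>_. 0" \<mu> 1]) (use assms in auto)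
  from chain_of_sequence[where p = "\<lambda>i. g (real i / N)" and n = N and w = w, OF N(2)]
  show ?thesis
    using that subdivision_le_curve_length[OF N(1), of g] N(1)
    by (simp add: pathstart_def pathfinish_def del: of_nat_Suc)
qed

text \<open>Once the lift moves by less than 1/2 per step, \<open>cdiff\<close> recovers each of its
  increments, and the sum telescopes.\<close>

lemma path_lift_chain:
  assumes "path g" "is_lift F (f \<circ> g)" "0 < \<mu>"
  obtains L where "chain (wt f) \<mu> (pathstart g) (pathfinish g) L (F 1 - F 0)" "ereal L \<le> curve_length g"
proof -
  obtain N :: nat where N: "N > 0" "\<And>i. i < N \<Longrightarrow> dist (g (real i / N)) (g (real (Suc i) / N)) < \<mu>"
    "\<And>i. i < N \<Longrightarrow> \<bar>F (real (Suc i) / N) - F (real i / N)\<bar> < 1/2"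
    by (rule fine_subdivision[OF assms(1), of F \<mu> "1/2"]) (use assms in \<open>auto simp: is_lift_def\<close>)
  have "wt f (g (real i / N)) (g (real (Suc i) / N)) = F (real (Suc i) / N) - F (real i / N)"
    if "i < N" for i
  proof -
    have "real i / N \<in> {0..1}" "real (Suc i) / N \<in> {0..1}"
      using that by auto
    then have "f (g (real i / N)) = circle_of (F (real i / N))"
      "f (g (real (Suc i) / N)) = circle_of (F (real (Suc i) / N))"
      using assms(2) unfolding is_lift_def by auto
    then show ?thesis
      unfolding wt_def using N(3)[OF that] by (simp add: cdiff_circle_of)
  qed
  then have "(\<Sum>i<N. wt f (g (real i / N)) (g (real (Suc i) / N))) =
      (\<Sum>i<N. F (real (Suc i) / N) - F (real i / N))"
    by (intro sum.cong) auto
  also have "\<dots> = F 1 - F 0"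
    using N(1) sum_lessThan_telescope[of "\<lambda>i. F (real i / N)" N] by simp
  finally show ?thesis
    using chain_of_sequence[where p = "\<lambda>i. g (real i / N)" and n = N and w = "wt f", OF N(2)] N(1)
      subdivision_le_curve_length[OF N(1), of g] that
    by (simp add: pathstart_def pathfinish_def del: of_nat_Suc)
qed

lemma curve_length_join:
  assumes "pathfinish g = pathstart h"
  shows "curve_length (g +++ h) \<le> curve_length g + curve_length h"
  unfolding curve_length_def[of "g +++ h"]
proof (rule SUP_least, clarify)
  fix n :: nat and t :: "nat \<Rightarrow> real"
  assume t: "\<forall>i\<le>n. t i \<in> {0..1}" "\<forall>i<n. t i \<le> t (Suc i)"
  \<comment> \<open>Clamping the subdivision to the two halves avoids inserting the point \<open>1/2\<close>.\<close>
  define a where "a = (\<lambda>i. min (2 * t i) 1)"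
  define b where "b = (\<lambda>i. max (2 * t i - 1) 0)"
  have eq: "g 1 = h 0" using assms by (simp add: pathstart_def pathfinish_def)
  have le: "dist ((g +++ h) (t i)) ((g +++ h) (t (Suc i)))
      \<le> dist (g (a i)) (g (a (Suc i))) + dist (h (b i)) (h (b (Suc i)))" if "i < n" for i
  proof -
    have "t i \<le> t (Suc i)" using t that by auto
    then consider "t (Suc i) \<le> 1/2" "t i \<le> 1/2" | "t i > 1/2" "t (Suc i) > 1/2" | "t i \<le> 1/2" "t (Suc i) > 1/2"
      by linarith
    then show ?thesis
    proof cases
      case 3
      then have "a (Suc i) = 1" "b i = 0" "a i = 2 * t i" "b (Suc i) = 2 * t (Suc i) - 1"
        by (auto simp: a_def b_def)
      then show ?thesis
        using 3 eq dist_triangle[of "g (2 * t i)" "h (2 * t (Suc i) - 1)" "g 1"]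
        by (simp add: joinpaths_def)
    qed (auto simp: a_def b_def joinpaths_def min_def max_def)
  qed
  have "ereal (\<Sum>i<n. dist ((g +++ h) (t i)) ((g +++ h) (t (Suc i))))
      \<le> ereal (\<Sum>i<n. dist (g (a i)) (g (a (Suc i)))) + ereal (\<Sum>i<n. dist (h (b i)) (h (b (Suc i))))"
    using le by (auto simp: sum.distrib[symmetric] intro!: sum_mono)
  also have "\<dots> \<le> curve_length g + curve_length h"
    unfolding curve_length_def
  proof (intro add_mono)
    show "ereal (\<Sum>i<n. dist (g (a i)) (g (a (Suc i)))) \<le>
      (SUP (n, t)\<in>{(n, t). (\<forall>i\<le>n. t i \<in> {0..1}) \<and> (\<forall>i<n. t i \<le> t (Suc i))}.
        ereal (\<Sum>i<n. dist (g (t i)) (g (t (Suc i)))))"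
      by (rule SUP_upper2[of "(n, a)"]) (use t in \<open>fastforce simp: a_def\<close>)+
    show "ereal (\<Sum>i<n. dist (h (b i)) (h (b (Suc i)))) \<le>
      (SUP (n, t)\<in>{(n, t). (\<forall>i\<le>n. t i \<in> {0..1}) \<and> (\<forall>i<n. t i \<le> t (Suc i))}.
        ereal (\<Sum>i<n. dist (h (t i)) (h (t (Suc i)))))"
      by (rule SUP_upper2[of "(n, b)"]) (use t in \<open>fastforce simp: b_def\<close>)+
  qed
  finally show "ereal (\<Sum>i<n. dist ((g +++ h) (t i)) ((g +++ h) (t (Suc i))))
      \<le> curve_length g + curve_length h" .
qed

lemma curve_length_const: "curve_length (\<lambda>_. x) = 0"
proof (rule antisym)
  show "curve_length (\<lambda>_. x) \<le> 0"
    unfolding curve_length_def by (rule SUP_least) (auto simp: zero_ereal_def)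
  show "0 \<le> curve_length (\<lambda>_. x)"
    using subdivision_le_curve_length[of 1 "\<lambda>_. x"] by (simp add: zero_ereal_def)
qed

lemma is_lift_join:
  assumes "is_lift F (f \<circ> g)" "is_lift G (f \<circ> h)" "pathfinish g = pathstart h"
  obtains H where "is_lift H (f \<circ> (g +++ h))" "H 1 - H 0 = (F 1 - F 0) + (G 1 - G 0)"
proof -
  \<comment> \<open>Both lifts cover the junction point, so the shift is an integer; it makes them
    agree there.\<close>
  define G' where "G' = (\<lambda>t. G t + (F 1 - G 0))"
  have "f (g 1) = circle_of (F 1)" "f (h 0) = circle_of (G 0)"
    using assms by (auto simp: is_lift_def)
  then have "F 1 - G 0 \<in> \<int>"
    using assms(3) by (metis circle_of_eq_iff pathfinish_def pathstart_def)
  then have "circle_of (G' t) = circle_of (G t)" for t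
    unfolding circle_of_eq_iff G'_def by simp
  then have G': "is_lift G' (f \<circ> h)"
    using assms(2) by (auto simp: is_lift_def G'_def intro!: continuous_intros)
  have "path (F +++ G')"
    using assms(1) G' by (intro path_join_imp) (auto simp: is_lift_def path_def pathfinish_def pathstart_def G'_def)
  then have "is_lift (F +++ G') (f \<circ> (g +++ h))"
    using assms(1) G' by (auto simp: is_lift_def path_def joinpaths_def)
  then show ?thesis
    by (rule that) (simp add: joinpaths_def G'_def)
qed

section \<open>Refining and realizing chains in compact length spaces\<close>

locale compact_length_space =
  fixes M :: "'a::metric_space itself"
  assumes compact_UNIV: "compact (UNIV :: 'a set)"
    and dist_eq_INF: "\<And>x y :: 'a. ereal (dist x y) =
        (INF g \<in> {g. path g \<and> pathstart g = x \<and> pathfinish g = y}. curve_length g)"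
begin

lemma almost_geodesic:
  fixes x y :: 'a
  assumes "0 < \<eta>"
  obtains g where "path g" "pathstart g = x" "pathfinish g = y" "curve_length g < ereal (dist x y + \<eta>)"
proof -
  have "ereal (dist x y) < ereal (dist x y + \<eta>)" using assms by simp
  then show ?thesis
    unfolding dist_eq_INF[of x y] INF_less_iff using that by auto
qed

lemma fine_chain:
  fixes x y :: 'a
  assumes "0 < \<mu>" "0 < \<eta>"
  obtains L C where "chain w \<mu> x y L C" "L < dist x y + \<eta>"
proof -
  obtain g where g: "path g" "pathstart g = x" "pathfinish g = y" "curve_length g < ereal (dist x y + \<eta>)"
    using almost_geodesic[OF assms(2)] .
  obtain L C where "chain w \<mu> (pathstart g) (pathfinish g) L C" "ereal L \<le> curve_length g"
    using path_fine_chain[OF g(1) assms(1)] .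
  then show ?thesis
    using g le_less_trans that by (metis ereal_less_eq(3) ereal_less(2) less_ereal.simps(1))
qed

text \<open>Each step is replaced by a fine chain of almost the same length. That chain is kept
  shorter than \<open>\<delta>\<close>, so by \<open>short_chain\<close> it has exactly the weight
  of the step: \<open>C\<close> is preserved and only the length grows.\<close>

lemma refine_chain:
  fixes x y :: 'a
  assumes w: "local_cocycle w \<delta>" and "0 < \<mu>" "chain w \<delta> x y L C" "0 < \<eta>"
  shows "\<exists>L'. L \<le> L' \<and> L' < L + \<eta> \<and> chain w \<mu> x y L' C"
  using assms(3,4)
proof (induction arbitrary: \<eta> rule: chain.induct)
  case (refl x)
  then show ?case by (intro exI[of _ 0]) (auto intro: chain.refl)
next
  case (step x y L C z)
  obtain L1 where L1: "L \<le> L1" "L1 < L + \<eta>/2" "chain w \<mu> x y L1 C"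
    using step.IH[of "\<eta>/2"] step.prems by auto
  define \<eta>' where "\<eta>' = min (\<eta>/2) (\<delta> - dist y z)"
  have "0 < \<eta>'" "0 < min \<mu> \<delta>"
    using step assms(2) w by (auto simp: \<eta>'_def local_cocycle_def)
  then obtain L2 C2 where 2: "chain w (min \<mu> \<delta>) y z L2 C2" "L2 < dist y z + \<eta>'"
    using fine_chain by blast
  have "C2 = w y z"
    by (rule short_chain[OF w 2(1)]) (use 2(2) in \<open>auto simp: \<eta>'_def\<close>)
  moreover have "chain w \<mu> y z L2 C2"
    using 2(1) by (rule chain_mono) simp
  ultimately show ?case
    using chain_trans[OF _ L1(3)] L1 2(2) chain_dist_le[OF 2(1)]
    by (intro exI[of _ "L1 + L2"]) (auto simp: \<eta>'_def)
qed

text \<open>A pair at distance below \<open>\<delta>\<close> is joined by a chain with steps below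
  \<open>\<mu>\<close> and length still below \<open>\<delta>\<close>; the coboundary telescopes
  along it, and \<open>short_chain\<close> evaluates both weights.\<close>

lemma local_cocycle_coboundary_extend:
  fixes w w' :: "'a \<Rightarrow> 'a \<Rightarrow> real"
  assumes w: "local_cocycle w \<delta>" and w': "local_cocycle w' \<delta>" and "0 < \<mu>"
    and eq: "\<And>x y. dist x y < \<mu> \<Longrightarrow> w' x y = w x y + u y - u x" and "dist x y < \<delta>"
  shows "w' x y = w x y + u y - u x"
proof -
  have "0 < min \<mu> \<delta>" "0 < \<delta> - dist x y"
    using assms by (auto simp: local_cocycle_def)
  then obtain L C where c: "chain w (min \<mu> \<delta>) x y L C" "L < dist x y + (\<delta> - dist x y)"
    using fine_chain by blast
  have "chain w' (min \<mu> \<delta>) x y L (C + u y - u x)"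
    using c(1) by (rule chain_weight_coboundary) (simp add: eq)
  from short_chain[OF w' this] short_chain[OF w c(1)] c(2) show ?thesis by simp
qed

text \<open>Consecutive points are joined by almost geodesics shorter than \<open>\<delta>\<close>,
  along which the lift gains exactly the weight of the step. Together with
  \<open>path_lift_chain\<close> this makes chains and paths interchangeable up to
  \<open>\<eta>\<close> in length.\<close>

lemma path_of_chain:
  fixes x y :: 'a and f :: "'a \<Rightarrow> circle"
  assumes f: "modulus f \<delta>" "continuous_on UNIV f" and "chain (wt f) \<delta> x y L C" "0 < \<eta>"
  shows "\<exists>g F. path g \<and> pathstart g = x \<and> pathfinish g = y \<and> curve_length g \<le> ereal (L + \<eta>) \<and>
    is_lift F (f \<circ> g) \<and> F 1 - F 0 = C"
  using assms(3,4)
proof (induction arbitrary: \<eta> rule: chain.induct)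
  case (refl x)
  obtain a where "f x = circle_of a" by (rule circle_of_surj)
  then show ?case
    using refl by (intro exI[of _ "\<lambda>_. x"] exI[of _ "\<lambda>_. a"])
      (auto simp: is_lift_def path_def pathstart_def pathfinish_def curve_length_const zero_ereal_def)
next
  case (step x y L C z)
  obtain g F where g: "path g" "pathstart g = x" "pathfinish g = y" "curve_length g \<le> ereal (L + \<eta>/2)"
    and F: "is_lift F (f \<circ> g)" "F 1 - F 0 = C"
    using step.IH[OF half_gt_zero[OF step.prems]] by blast
  have "0 < min (\<eta>/2) (\<delta> - dist y z)" using step by auto
  then obtain h where h: "path h" "pathstart h = y" "pathfinish h = z"
    "curve_length h < ereal (dist y z + min (\<eta>/2) (\<delta> - dist y z))"
    using almost_geodesic by blast
  have "continuous_on {0..1} (f \<circ> h)"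
    using h(1) f(2) by (intro continuous_on_compose) (auto simp: path_def elim: continuous_on_subset)
  then obtain G where G: "is_lift G (f \<circ> h)"
    by (rule path_lift) (auto simp: is_lift_def)
  obtain L' where L': "chain (wt f) \<delta> y z L' (G 1 - G 0)" "ereal L' \<le> curve_length h"
    using path_lift_chain[OF h(1) G, of \<delta>] f(1) h by (auto simp: modulus_def)
  have "ereal L' < ereal (dist y z + min (\<eta>/2) (\<delta> - dist y z))"
    using L'(2) h(4) by (rule le_less_trans)
  then have "L' < \<delta>" by simp
  then have G': "G 1 - G 0 = wt f y z"
    using short_chain[OF modulus_local_cocycle[OF f(1)] L'(1)] by simp
  obtain H where "is_lift H (f \<circ> (g +++ h))" "H 1 - H 0 = C + wt f y z"
    using is_lift_join[OF F(1) G] F(2) G' g h by metis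
  moreover have "curve_length (g +++ h) \<le> ereal (L + dist y z + \<eta>)"
  proof -
    have "curve_length (g +++ h) \<le> curve_length g + curve_length h"
      using g h by (intro curve_length_join) simp
    also have "\<dots> \<le> ereal (L + \<eta>/2) + ereal (dist y z + min (\<eta>/2) (\<delta> - dist y z))"
      using g h by (intro add_mono) auto
    also have "\<dots> \<le> ereal (L + dist y z + \<eta>)" by simp
    finally show ?thesis .
  qed
  moreover have "path (g +++ h)" "pathstart (g +++ h) = x" "pathfinish (g +++ h) = z"
    using g h by auto
  ultimately show ?case by blast
qed

end

section \<open>Tight representatives\<close>

text \<open>Greedily cutting the chain into pieces of length at least \<open>\<delta>/2\<close>; \<open>z\<close> is the last cut.\<close>
lemma chain_weight_growth:
  assumes f: "modulus f \<delta>" and "chain (wt f) (\<delta>/2) x y L C"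
  shows "\<exists>(m::nat) z. \<bar>C - wt f z y\<bar> \<le> m / 4 \<and> m * (\<delta>/2) + dist z y \<le> L \<and> dist z y < \<delta>/2"
  using assms(2)
proof (induction rule: chain.induct)
  case (refl x)
  then show ?case
    using f by (intro exI[of _ 0] exI[of _ x]) (simp add: wt_def modulus_def)
next
  case (step x y L C y')
  then obtain m :: nat and z where z: "\<bar>C - wt f z y\<bar> \<le> m / 4" "m * (\<delta>/2) + dist z y \<le> L" "dist z y < \<delta>/2"
    by blast
  have "dist z y' \<le> dist z y + dist y y'" by (rule dist_triangle)
  then have lt: "dist z y' < \<delta>" "dist z y < \<delta>" "dist y y' < \<delta>"
    using z step.hyps(2) zero_le_dist[of z y] zero_le_dist[of y y'] by linarith+
  have add: "wt f z y' = wt f z y + wt f y y'"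
    using modulus_local_cocycle[OF f] lt unfolding local_cocycle_def by blast
  show ?case
  proof (cases "dist z y + dist y y' < \<delta>/2")
    case True
    then show ?thesis
      using z add \<open>dist z y' \<le> dist z y + dist y y'\<close> by (intro exI[of _ m] exI[of _ z]) auto
  next
    case False
    have "\<bar>wt f z y'\<bar> \<le> 1/4"
      using f lt unfolding modulus_def wt_def abs_cdiff by (auto intro: less_imp_le)
    then have "\<bar>C + wt f y y'\<bar> \<le> m / 4 + 1 / 4"
      using z(1) add by linarith
    then have "\<bar>C + wt f y y' - wt f y' y'\<bar> \<le> Suc m / 4"
      by (simp add: wt_def add_divide_distrib)
    moreover have "Suc m * (\<delta>/2) + dist y' y' \<le> L + dist y y'"
      using z(2) False by (simp add: distrib_right)
    moreover have "dist y' y' < \<delta>/2"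
      using f by (simp add: modulus_def)
    ultimately show ?thesis by blast
  qed
qed

section \<open>Weights and degrees in a homotopy class\<close>

locale circle_class = compact_length_space M for M :: "'a::metric_space itself" +
  fixes \<phi> :: "('a \<Rightarrow> circle) set"
  assumes homotopy_class: "homotopy_class \<phi>"
    and nontrivial: "nontrivial_class \<phi>"
begin

lemma class_homotopic:
  assumes "f \<in> \<phi>" "g \<in> \<phi>"
  shows "homotopic_with_canon (\<lambda>_. True) UNIV UNIV f g"
proof -
  obtain h where "homotopic_with_canon (\<lambda>_. True) UNIV UNIV h f" "homotopic_with_canon (\<lambda>_. True) UNIV UNIV h g"
    using homotopy_class assms unfolding homotopy_class_def by blast
  then show ?thesis
    using homotopic_with_trans homotopic_with_symD by blast
qed

lemma class_continuous: "f \<in> \<phi> \<Longrightarrow> continuous_on UNIV f"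
  using class_homotopic homotopic_with_imp_continuous by blast

lemma class_nonempty: obtains f where "f \<in> \<phi>"
proof -
  obtain f where "continuous_on UNIV f" "\<phi> = {g. homotopic_with_canon (\<lambda>_. True) UNIV UNIV f g}"
    using homotopy_class unfolding homotopy_class_def by auto
  then have "f \<in> \<phi>" by simp
  then show ?thesis by (rule that)
qed

lemma class_rotation:
  assumes "f \<in> \<phi>" "g \<in> \<phi>"
  obtains u where "continuous_on UNIV u" "\<And>p. g p = rot (f p) (u p)"
proof -
  obtain h :: "real \<times> 'a \<Rightarrow> circle" where h: "continuous_on ({0..1} \<times> UNIV) h" "\<And>x. h (0, x) = f x" "\<And>x. h (1, x) = g x"
    using class_homotopic[OF assms] unfolding homotopic_with_def prod_topology_subtopology_eu
    by (auto simp del: subtopology_UNIV)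
  show ?thesis
    using homotopy_rotation[OF compact_UNIV h(1)] h(2,3) that by auto
qed

text \<open>Scaling \<open>u\<close> from 0 to 1 is the homotopy.\<close>

lemma rotation_class:
  assumes f: "f \<in> \<phi>" and u: "continuous_on UNIV u"
  shows "(\<lambda>p. rot (f p) (u p)) \<in> \<phi>"
proof -
  have f': "continuous_on UNIV f" using f by (rule class_continuous)
  have "continuous_on ({0..1} \<times> UNIV) (\<lambda>z. rot (f (snd z)) (fst z * u (snd z)))"
    by (intro continuous_intros continuous_on_compose2[OF f'] continuous_on_compose2[OF u]) auto
  then have "homotopic_with_canon (\<lambda>_. True) UNIV UNIV f (\<lambda>p. rot (f p) (u p))"
    unfolding homotopic_with_def prod_topology_subtopology_eu
    by (intro exI[of _ "\<lambda>z. rot (f (snd z)) (fst z * u (snd z))"]) (auto simp del: subtopology_UNIV)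
  then show ?thesis
    using homotopy_class f homotopic_with_trans unfolding homotopy_class_def by blast
qed

lemma modulus_exists:
  assumes "f \<in> \<phi>"
  obtains \<delta> where "modulus f \<delta>"
proof -
  have "uniformly_continuous_on UNIV f"
    using compact_uniformly_continuous[OF class_continuous[OF assms] compact_UNIV] .
  then obtain d where "d > 0" "\<And>x y. dist x y < d \<Longrightarrow> dist (f x) (f y) < 1/4"
    unfolding uniformly_continuous_on_def
    by (metis UNIV_I zero_less_divide_1_iff zero_less_numeral)
  then show ?thesis using that by (auto simp: modulus_def)
qed

text \<open>Where the rotation function \<open>u\<close> varies by less than 1/4, both sides are
  below 1/2 in absolute value and rotate \<open>g x\<close> to \<open>g y\<close>, hence agree. The
  identity then extends to the common modulus, with a \<open>u\<close> that does not depend on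
  \<open>\<delta>\<close>.\<close>

lemma wt_class:
  assumes fg: "f \<in> \<phi>" "g \<in> \<phi>"
  obtains u where "\<And>\<delta> x y. modulus f \<delta> \<Longrightarrow> modulus g \<delta> \<Longrightarrow> dist x y < \<delta> \<Longrightarrow>
    wt g x y = wt f x y + u y - u x"
proof -
  obtain u where u: "continuous_on UNIV u" "\<And>p. g p = rot (f p) (u p)"
    using class_rotation[OF fg] by blast
  show ?thesis
  proof (rule that[of u])
    fix \<delta> and x y :: 'a assume f: "modulus f \<delta>" and g: "modulus g \<delta>" and "dist x y < \<delta>"
    have "uniformly_continuous_on UNIV u"
      using compact_uniformly_continuous[OF u(1) compact_UNIV] .
    then obtain d where d: "d > 0" "\<And>x y. dist y x < d \<Longrightarrow> dist (u y) (u x) < 1/4"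
      unfolding uniformly_continuous_on_def
      by (metis UNIV_I zero_less_divide_1_iff zero_less_numeral)
    show "wt g x y = wt f x y + u y - u x"
    proof (rule local_cocycle_coboundary_extend[of _ _ _ "min d \<delta>"])
      show "wt g x y = wt f x y + u y - u x" if xy: "dist x y < min d \<delta>" for x y
      proof -
        have "dist (u x) (u y) < 1/4" "\<bar>wt f x y\<bar> < 1/4"
          using d(2)[of x y] f xy by (auto simp: modulus_def wt_def abs_cdiff)
        then have "\<bar>wt f x y + u y - u x\<bar> < 1/2"
          unfolding dist_real_def by linarith
        moreover have "rot (g x) (wt f x y + u y - u x) = rot (rot (f x) (wt f x y)) (u y)"
          unfolding u(2) rot_rot by (simp add: algebra_simps)
        then have "rot (g x) (wt f x y + u y - u x) = g y"
          unfolding u(2)[of y] by (simp only: wt_def rot_cdiff)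
        ultimately show ?thesis
          unfolding wt_def[of g] by (metis cdiff_rot)
      qed
    qed (use f g d \<open>dist x y < \<delta>\<close> in \<open>auto intro: modulus_local_cocycle simp: modulus_def\<close>)
  qed
qed

lemma lift_exists:
  assumes "f \<in> \<phi>" "path g"
  obtains F where "is_lift F (f \<circ> g)"
proof -
  have "continuous_on {0..1} (f \<circ> g)"
    using assms(2) class_continuous[OF assms(1)]
    by (intro continuous_on_compose) (auto simp: path_def elim: continuous_on_subset)
  then show ?thesis
    by (rule path_lift) (use that in \<open>auto simp: is_lift_def\<close>)
qed

text \<open>Two representatives differ along the loop by the single-valued function \<open>u\<close>
  of its points, whose total increment is 0. So all representatives have the same degree and the
  definite description denotes it.\<close>

lemma class_degree_eq:
  assumes f: "f \<in> \<phi>" and g: "path g" "pathfinish g = pathstart g" and F: "is_lift F (f \<circ> g)"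
  shows "real_of_int (class_degree \<phi> g) = F 1 - F 0"
proof -
  have g01: "g 0 = g 1" using g by (simp add: pathstart_def pathfinish_def)
  have same: "loop_degree (f' \<circ> g) = loop_degree (f \<circ> g)" if "f' \<in> \<phi>" for f'
  proof -
    obtain u where u: "continuous_on UNIV u" "\<And>p. f' p = rot (f p) (u p)"
      using class_rotation[OF f \<open>f' \<in> \<phi>\<close>] by blast
    have "continuous_on {0..1} (\<lambda>t. u (g t))"
      using g(1) by (intro continuous_on_compose2[OF u(1)]) (auto simp: path_def)
    then have "is_lift (\<lambda>t. F t + u (g t)) (f' \<circ> g)"
      using F u(2) by (auto simp: is_lift_def intro!: continuous_intros)
    from loop_degree_eq[OF this] loop_degree_eq[OF F] g01 show ?thesis by simp
  qed
  then have "class_degree \<phi> g = loop_degree (f \<circ> g)"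
    unfolding class_degree_def using f by (intro the_equality ballI) (blast, metis)
  then show ?thesis
    using loop_degree_eq[OF F] g01 by simp
qed

section \<open>The critical constant and the cost of closed chains\<close>

definition Ksup :: ereal where
  "Ksup = (SUP g \<in> closed_curves. ereal (of_int (class_degree \<phi> g)) / curve_length g)"

text \<open>The \<open>max\<close> makes \<open>K\<close> nonnegative before nontriviality of the
  class is used; \<open>Ksup_eq\<close> later identifies it with the supremum.\<close>

definition K :: real where
  "K = max 0 (real_of_ereal Ksup)"

lemma closed_curvesE:
  assumes "g \<in> closed_curves"
  obtains l where "path g" "pathfinish g = pathstart g" "curve_length g = ereal l" "l > 0"
  using assms that unfolding closed_curves_def
  by (cases "curve_length g") auto

text \<open>Cutting a loop of length \<open>l\<close> into \<open>m\<close> pieces of length at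
  least \<open>\<delta>/2\<close> bounds its degree by \<open>m / 4 + 1/4\<close>. If
  \<open>m\<close> is 0, integrality forces degree 0; otherwise the bound is at most
  \<open>m / 2\<close>, hence at most \<open>l / \<delta>\<close>.\<close>

lemma Ksup_finite: "Ksup \<noteq> \<infinity>"
proof -
  obtain f where f: "f \<in> \<phi>" by (rule class_nonempty)
  obtain \<delta> where \<delta>: "modulus f \<delta>" using modulus_exists[OF f] .
  have \<delta>0: "\<delta> > 0" using \<delta> by (simp add: modulus_def)
  have "ereal (of_int (class_degree \<phi> g)) / curve_length g \<le> ereal (1/\<delta>)"
    if gc: "g \<in> closed_curves" for g :: "real \<Rightarrow> 'a"
  proof -
    obtain l where g: "path g" "pathfinish g = pathstart g" "curve_length g = ereal l" "l > 0"
      using closed_curvesE[OF gc] .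
    obtain F where F: "is_lift F (f \<circ> g)" using lift_exists[OF f g(1)] .
    define n where "n = class_degree \<phi> g"
    have n: "F 1 - F 0 = of_int n"
      using class_degree_eq[OF f g(1,2) F] by (simp add: n_def)
    obtain L where L: "chain (wt f) (\<delta>/2) (pathstart g) (pathfinish g) L (of_int n)" "L \<le> l"
      using path_lift_chain[OF g(1) F, of "\<delta>/2"] \<delta>0 unfolding n g by auto
    obtain m :: nat and z where m: "\<bar>of_int n - wt f z (pathfinish g)\<bar> \<le> m / 4"
      "m * (\<delta>/2) + dist z (pathfinish g) \<le> L" "dist z (pathfinish g) < \<delta>/2"
      using chain_weight_growth[OF \<delta> L(1)] by blast
    have "\<bar>wt f z (pathfinish g)\<bar> < 1/4"
      using \<delta> m(3) \<delta>0 unfolding wt_def abs_cdiff modulus_def by auto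
    then have n': "\<bar>real_of_int n\<bar> \<le> m / 4 + 1/4" using m(1) by linarith
    have "real_of_int n \<le> l / \<delta>"
    proof (cases "m = 0")
      case True
      then have "n = 0" using n' by linarith
      then show ?thesis using g \<delta>0 by simp
    next
      case False
      then have "real_of_int n \<le> m / 2" using n' by linarith
      moreover have "m * \<delta> \<le> 2 * l"
        using m(2) L(2) zero_le_dist[of z "pathfinish g"] by argo
      then have "m / 2 \<le> l / \<delta>" using \<delta>0 by (simp add: field_simps)
      ultimately show ?thesis by linarith
    qed
    then show ?thesis
      using g \<delta>0 by (simp add: n_def field_simps)
  qed
  then have "Ksup \<le> ereal (1/\<delta>)"
    unfolding Ksup_def by (rule SUP_least)
  then show ?thesis by auto
qed

lemma Ksup_le_K: "Ksup \<le> ereal K"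
  using Ksup_finite by (cases Ksup) (auto simp: K_def)

lemma K_nonneg: "0 \<le> K"
  by (simp add: K_def)

text \<open>The chain is realized by a closed curve of length at most \<open>L + \<eta>\<close> and
  degree \<open>C\<close>, to which the supremum applies; then \<open>\<eta>\<close> tends to
  0.\<close>

lemma closed_chain_cost_nonneg:
  assumes f: "f \<in> \<phi>" "modulus f \<delta>" and c: "chain (wt f) \<delta> x x L C"
  shows "C \<le> K * L"
proof -
  have le: "C \<le> K * (L + \<eta>)" if "\<eta> > 0" for \<eta>
  proof -
    obtain g F where g: "path g" "pathstart g = x" "pathfinish g = x" "curve_length g \<le> ereal (L + \<eta>)"
      and F: "is_lift F (f \<circ> g)" "F 1 - F 0 = C"
      using path_of_chain[OF f(2) class_continuous[OF f(1)] c \<open>\<eta> > 0\<close>] by blast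
    obtain L' where L': "chain (wt f) \<delta> x x L' C" "ereal L' \<le> curve_length g"
      using path_lift_chain[OF g(1) F(1), of \<delta>] f(2) g F by (auto simp: modulus_def)
    have L'0: "L' \<ge> 0" using chain_dist_le[OF L'(1)] by simp
    show ?thesis
    \<comment> \<open>Curves of zero length are excluded from the supremum, but for them
      \<open>short_chain\<close> gives \<open>C = 0\<close> directly.\<close>
    proof (cases "curve_length g \<le> 0")
      case True
      then have "L' = 0" using L'0 L'(2) order_trans by fastforce
      then have "C = wt f x x"
        using short_chain[OF modulus_local_cocycle[OF f(2)] L'(1)] f(2) by (simp add: modulus_def)
      then show ?thesis
        using K_nonneg L'0 \<open>\<eta> > 0\<close> chain_dist_le[OF c] by (simp add: wt_def)
    next
      case False
      then have "g \<in> closed_curves"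
        using g le_less_trans[OF g(4), of \<infinity>] by (auto simp: closed_curves_def)
      then obtain l where l: "curve_length g = ereal l" "l > 0"
        using closed_curvesE by metis
      have "ereal (of_int (class_degree \<phi> g)) / curve_length g \<le> Ksup"
        unfolding Ksup_def using \<open>g \<in> closed_curves\<close> by (rule SUP_upper)
      also note Ksup_le_K
      finally have "C / l \<le> K"
        using class_degree_eq[OF f(1) g(1) _ F(1)] g F l by simp
      then have "C \<le> K * l" using l by (simp add: field_simps)
      also have "\<dots> \<le> K * (L + \<eta>)"
        using K_nonneg g(4) l by (intro mult_left_mono) auto
      finally show ?thesis .
    qed
  qed
  show ?thesis
  proof (rule tendsto_lowerbound)
    show "((\<lambda>\<eta>. K * (L + \<eta>)) \<longlongrightarrow> K * L) (at_right 0)"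
      by (auto intro!: tendsto_eq_intros)
    show "\<forall>\<^sub>F \<eta> in at_right 0. C \<le> K * (L + \<eta>)"
      using le by (auto simp: eventually_at_right_field intro: exI[of _ 1])
  qed simp
qed

section \<open>Subsolutions and the potential\<close>

text \<open>A discrete form of the Hamilton-Jacobi inequality that the norm of
  \<open>df + du\<close> is at most \<open>K\<close>. Exchanging \<open>y\<close> and
  \<open>z\<close> gives the bound from the other side.\<close>

definition subsolution :: "('a \<Rightarrow> circle) \<Rightarrow> real \<Rightarrow> ('a \<Rightarrow> real) \<Rightarrow> bool" where
  "subsolution f \<delta> u \<longleftrightarrow> (\<forall>y z. dist y z < \<delta> \<longrightarrow> u z - u y \<le> K * dist y z - wt f y z)"

text \<open>The two-sided bound makes the rotated map \<open>K\<close>-Lipschitz at scale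
  \<open>\<delta>\<close>; adding it up along almost shortest chains makes it global. Continuity of
  \<open>u\<close>, needed for membership in the class, follows from the same bound.\<close>

lemma subsolution_lipschitz:
  assumes f: "f \<in> \<phi>" "modulus f \<delta>" and u: "subsolution f \<delta> u"
  defines "\<tau> \<equiv> \<lambda>p. rot (f p) (u p)"
  shows "\<tau> \<in> \<phi>" "K-lipschitz_on UNIV \<tau>"
proof -
  have \<delta>: "\<delta> > 0" using f by (simp add: modulus_def)
  have both: "\<bar>u z - u y + wt f y z\<bar> \<le> K * dist y z" if "dist y z < \<delta>" for y z
    using u that local_cocycle_sym[OF modulus_local_cocycle[OF f(2)] that]
    unfolding subsolution_def abs_le_iff by (smt (verit) dist_commute)
  have "continuous_on UNIV u"
    unfolding continuous_on_def tendsto_iff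
  proof (intro ballI allI impI)
    fix x and e :: real assume e: "e > 0"
    have "((\<lambda>y. K * dist y x + dist (f y) (f x)) \<longlongrightarrow> K * dist x x + dist (f x) (f x)) (at x)"
      using class_continuous[OF f(1)] by (intro tendsto_intros) (auto simp: continuous_on_def)
    then have "\<forall>\<^sub>F y in at x. K * dist y x + dist (f y) (f x) < e"
      using e by (auto dest: order_tendstoD(2))
    moreover have "\<forall>\<^sub>F y in at x. dist y x < \<delta>"
      using \<delta> by (auto simp: eventually_at)
    ultimately show "\<forall>\<^sub>F y in at x. dist (u y) (u x) < e"
    proof eventually_elim
      case (elim y)
      have "\<bar>wt f y x\<bar> = dist (f y) (f x)" by (simp add: wt_def abs_cdiff)
      then show ?case
        using both[OF elim(2)] elim(1) by (simp add: dist_real_def)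
    qed
  qed
  then show "\<tau> \<in> \<phi>"
    unfolding \<tau>_def by (rule rotation_class[OF f(1)])
  have loc: "dist (\<tau> y) (\<tau> z) \<le> K * dist y z" if "dist y z < \<delta>" for y z
  proof -
    have "\<tau> z = rot (f y) (wt f y z + u z)"
      unfolding \<tau>_def wt_def by (simp only: rot_rot[symmetric] rot_cdiff)
    then have "dist (\<tau> y) (\<tau> z) \<le> \<bar>u y - (wt f y z + u z)\<bar>"
      using dist_rot_rot_le[of "f y" "u y" "f y" "wt f y z + u z"] by (simp add: \<tau>_def)
    also have "\<dots> \<le> K * dist y z" using both[OF that] by linarith
    finally show ?thesis .
  qed
  have glob: "dist (\<tau> x) (\<tau> y) \<le> K * L" if "chain w \<delta> x y L C" for w x y L C
    using that
  proof (induction rule: chain.induct)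
    case (step x y L C z)
    then show ?case
      using loc[OF step.hyps(2)] dist_triangle[of "\<tau> x" "\<tau> z" "\<tau> y"] by (simp add: algebra_simps)
  qed simp
  show "K-lipschitz_on UNIV \<tau>"
  proof (rule lipschitz_onI[OF _ K_nonneg])
    fix x y
    have "dist (\<tau> x) (\<tau> y) \<le> K * (dist x y + \<eta>)" if \<eta>: "\<eta> > 0" for \<eta>
    proof -
      obtain L C where "chain (\<lambda>_ _. 0) \<delta> x y L C" "L < dist x y + \<eta>"
        using fine_chain[OF \<delta> \<eta>] .
      then show ?thesis
        using glob K_nonneg by (meson less_imp_le mult_left_mono order_trans)
    qed
    then have "\<forall>\<^sub>F \<eta> in at_right 0. dist (\<tau> x) (\<tau> y) \<le> K * (dist x y + \<eta>)"
      by (auto simp: eventually_at_right_field intro: exI[of _ 1])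
    moreover have "((\<lambda>\<eta>. K * (dist x y + \<eta>)) \<longlongrightarrow> K * dist x y) (at_right 0)"
      by (auto intro!: tendsto_eq_intros)
    ultimately show "dist (\<tau> x) (\<tau> y) \<le> K * dist x y"
      by (intro tendsto_lowerbound[of _ _ "at_right 0"]) auto
  qed
qed

text \<open>The Mane potential of Aubry-Mather theory: the infimal cost of chains from
  \<open>x\<close> to \<open>y\<close>.\<close>

definition potential :: "('a \<Rightarrow> circle) \<Rightarrow> real \<Rightarrow> 'a \<Rightarrow> 'a \<Rightarrow> real" where
  "potential f \<delta> x y = Inf {K * L - C | L C. chain (wt f) \<delta> x y L C}"

context
  fixes f \<delta> assumes f: "f \<in> \<phi>" "modulus f \<delta>"
begin

lemma chain_exists: obtains L C where "chain (wt f) \<delta> x y L C"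
proof -
  have "0 < \<delta>" using f(2) by (simp add: modulus_def)
  then show ?thesis using that fine_chain[of \<delta> 1] zero_less_one by metis
qed

lemma potential_le:
  assumes "chain (wt f) \<delta> x y L C"
  shows "potential f \<delta> x y \<le> K * L - C"
  unfolding potential_def
proof (rule cInf_lower)
  \<comment> \<open>A fixed return chain closes up every competitor, so the nonnegative cost of
    closed chains bounds the infimum from below.\<close>
  obtain L' C' where bk: "chain (wt f) \<delta> y x L' C'" by (rule chain_exists)
  show "bdd_below {K * L - C | L C. chain (wt f) \<delta> x y L C}"
  proof (rule bdd_belowI)
    fix c assume "c \<in> {K * L - C | L C. chain (wt f) \<delta> x y L C}"
    then obtain L C where c: "c = K * L - C" "chain (wt f) \<delta> x y L C" by auto
    from closed_chain_cost_nonneg[OF f chain_trans[OF bk c(2)]]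
    show "C' - K * L' \<le> c" using c(1) by (simp add: algebra_simps)
  qed
qed (use assms in auto)

lemma potential_ge:
  assumes "\<And>L C. chain (wt f) \<delta> x y L C \<Longrightarrow> c \<le> K * L - C"
  shows "c \<le> potential f \<delta> x y"
  unfolding potential_def
proof (rule cInf_greatest)
  show "{K * L - C |L C. chain (wt f) \<delta> x y L C} \<noteq> {}"
    using chain_exists by blast
qed (use assms in auto)

lemma subsolution_potential_from: "subsolution f \<delta> (potential f \<delta> x)"
  unfolding subsolution_def
proof (intro allI impI)
  fix y z :: 'a assume yz: "dist y z < \<delta>"
  have "potential f \<delta> x z - (K * dist y z - wt f y z) \<le> potential f \<delta> x y"
  proof (rule potential_ge)
    fix L C assume "chain (wt f) \<delta> x y L C"
    from potential_le[OF chain.step[OF this yz]]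
    show "potential f \<delta> x z - (K * dist y z - wt f y z) \<le> K * L - C"
      by (simp add: algebra_simps)
  qed
  then show "potential f \<delta> x z - potential f \<delta> x y \<le> K * dist y z - wt f y z" by simp
qed

lemma subsolution_potential_to: "subsolution f \<delta> (\<lambda>y. - potential f \<delta> y x)"
  unfolding subsolution_def
proof (intro allI impI)
  fix y z :: 'a assume yz: "dist y z < \<delta>"
  have "potential f \<delta> y x - (K * dist y z - wt f y z) \<le> potential f \<delta> z x"
  proof (rule potential_ge)
    fix L C assume "chain (wt f) \<delta> z x L C"
    from potential_le[OF chain_trans[OF this chain_single[OF yz]]]
    show "potential f \<delta> y x - (K * dist y z - wt f y z) \<le> K * L - C"
      by (simp add: algebra_simps)
  qed
  then show "- potential f \<delta> z x - - potential f \<delta> y x \<le> K * dist y z - wt f y z" by simp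
qed

end

section \<open>Characterization of tight representatives\<close>

lemma Lipschitz_representative_exists:
  obtains \<tau> where "\<tau> \<in> \<phi>" "K-lipschitz_on UNIV \<tau>"
proof -
  obtain f where f: "f \<in> \<phi>" by (rule class_nonempty)
  obtain \<delta> where \<delta>: "modulus f \<delta>" using modulus_exists[OF f] .
  show ?thesis
    by (rule that) (rule subsolution_lipschitz[OF f \<delta> subsolution_potential_from[OF f \<delta>]])+
qed

text \<open>Here nontriviality enters: a 0-Lipschitz representative would be constant.\<close>

lemma K_pos: "0 < K"
proof (rule ccontr)
  assume "\<not> 0 < K"
  then have "K = 0" using K_nonneg by simp
  obtain \<tau> where \<tau>: "\<tau> \<in> \<phi>" "K-lipschitz_on UNIV \<tau>"
    by (rule Lipschitz_representative_exists)
  then have "dist (\<tau> x) (\<tau> y) \<le> 0" for x y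
    using \<open>K = 0\<close> lipschitz_onD[OF \<tau>(2), of x y] by simp
  then have "\<tau> x = \<tau> y" for x y by (simp add: dist_le_zero_iff)
  then have "\<tau> = (\<lambda>_. \<tau> undefined)" by (intro ext)
  then show False
    using \<tau>(1) nontrivial unfolding nontrivial_class_def by metis
qed

lemma Ksup_eq: "Ksup = ereal K"
  using K_pos Ksup_finite by (cases Ksup) (auto simp: K_def max_def split: if_splits)

lemma Ksup_le_Lipschitz:
  assumes f: "f \<in> \<phi>" "B-lipschitz_on UNIV f"
  shows "Ksup \<le> ereal B"
  unfolding Ksup_def
proof (rule SUP_least)
  fix g :: "real \<Rightarrow> 'a" assume "g \<in> closed_curves"
  then obtain l where g: "path g" "pathfinish g = pathstart g" "curve_length g = ereal l" "l > 0"
    using closed_curvesE by metis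
  obtain F where F: "is_lift F (f \<circ> g)" using lift_exists[OF f(1) g(1)] .
  obtain L where L: "chain (wt f) 1 (pathstart g) (pathfinish g) L (F 1 - F 0)" "L \<le> l"
    using path_lift_chain[OF g(1) F, of 1] g by auto
  have "C \<le> B * L" if "chain (wt f) 1 x y L C" for x y L C
    using that
  proof (induction rule: chain.induct)
    case (step x y L C z)
    have "wt f y z \<le> B * dist y z"
      using lipschitz_onD[OF f(2), of y z] abs_cdiff[of "f y" "f z"] by (simp add: wt_def)
    then show ?case using step.IH by (simp add: algebra_simps)
  qed simp
  then have "F 1 - F 0 \<le> B * L" using L(1) .
  also have "\<dots> \<le> B * l"
    using L(2) lipschitz_on_nonneg[OF f(2)] by (intro mult_left_mono)
  finally show "ereal (of_int (class_degree \<phi> g)) / curve_length g \<le> ereal B"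
    using class_degree_eq[OF f(1) g(1,2) F] g by (simp add: field_simps)
qed

text \<open>The infimum defining \<open>Lip_const\<close> is attained, by letting
  \<open>\<eta>\<close> tend to 0, and by \<open>Ksup_le_Lipschitz\<close> no representative has a
  constant below \<open>K\<close>.\<close>

lemma tight_iff: "tight \<phi> \<tau> \<longleftrightarrow> \<tau> \<in> \<phi> \<and> K-lipschitz_on UNIV \<tau>"
proof (intro iffI conjI; (elim conjE)?)
  assume t: "tight \<phi> \<tau>"
  then show "\<tau> \<in> \<phi>" by (simp add: tight_def)
  have lip: "Lip_const UNIV \<tau> = ereal K"
    using t Ksup_eq by (simp add: tight_def Ksup_def)
  show "K-lipschitz_on UNIV \<tau>"
  proof (rule lipschitz_onI[OF _ K_nonneg])
    fix x y
    have "dist (\<tau> x) (\<tau> y) \<le> (K + \<eta>) * dist x y" if "\<eta> > 0" for \<eta>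
    proof -
      have "Lip_const UNIV \<tau> < ereal (K + \<eta>)" using lip that by simp
      then obtain B where "B-lipschitz_on UNIV \<tau>" "B < K + \<eta>"
        unfolding Lip_const_def INF_less_iff by auto
      then show ?thesis
        using lipschitz_onD[of B UNIV \<tau> x y] by (meson UNIV_I less_imp_le mult_right_mono order_trans zero_le_dist)
    qed
    then have "\<forall>\<^sub>F \<eta> in at_right 0. dist (\<tau> x) (\<tau> y) \<le> (K + \<eta>) * dist x y"
      by (auto simp: eventually_at_right_field intro: exI[of _ 1])
    moreover have "((\<lambda>\<eta>. (K + \<eta>) * dist x y) \<longlongrightarrow> K * dist x y) (at_right 0)"
      by (auto intro!: tendsto_eq_intros)
    ultimately show "dist (\<tau> x) (\<tau> y) \<le> K * dist x y"
      by (intro tendsto_lowerbound[of _ _ "at_right 0"]) auto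
  qed
next
  assume \<tau>: "\<tau> \<in> \<phi>" "K-lipschitz_on UNIV \<tau>"
  have "Lip_const UNIV \<tau> = Ksup"
  proof (rule antisym)
    show "Lip_const UNIV \<tau> \<le> Ksup"
      unfolding Ksup_eq Lip_const_def using \<tau>(2) by (intro INF_lower) auto
    show "Ksup \<le> Lip_const UNIV \<tau>"
      unfolding Lip_const_def using Ksup_le_Lipschitz[OF \<tau>(1)] by (intro INF_greatest) auto
  qed
  then show "tight \<phi> \<tau>"
    using \<tau>(1) by (simp add: tight_def Ksup_def)
qed

lemma tight_Lip_const: "tight \<phi> \<tau> \<Longrightarrow> Lip_const UNIV \<tau> = ereal K"
  using Ksup_eq by (simp add: tight_def Ksup_def)

end

section \<open>Leaves and chain recurrence\<close>

text \<open>Tychonoff gives a cluster point, not a convergent subsequence, since the index type may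
  be uncountable. Hence closeness holds only for arbitrarily large \<open>n\<close> and on finite
  sets of parameters.\<close>

lemma product_cluster_point:
  fixes c :: "nat \<Rightarrow> 'b \<Rightarrow> 'a::metric_space"
  assumes "compact (UNIV :: 'a set)"
  obtains g where "\<And>F e N. finite F \<Longrightarrow> 0 < e \<Longrightarrow> \<exists>n\<ge>N. \<forall>t\<in>F. dist (c n t) (g t) < e"
proof -
  have "compactin (product_topology (\<lambda>_::'b. euclidean) UNIV) (PiE UNIV (\<lambda>_. UNIV :: 'a set))"
    unfolding compactin_PiE using assms by simp
  then have "compact (UNIV :: ('b \<Rightarrow> 'a) set)"
    by (simp add: euclidean_product_topology)
  then obtain g where g: "inf (nhds g) (filtermap c sequentially) \<noteq> bot"
    unfolding compact_filter
    by (auto simp: filtermap_bot_iff dest!: spec[of _ "filtermap c sequentially"])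
  show ?thesis
  proof (rule that[of g], rule ccontr)
    fix F :: "'b set" and e :: real and N :: nat
    assume F: "finite F" "0 < e" and neg: "\<not> (\<exists>n\<ge>N. \<forall>t\<in>F. dist (c n t) (g t) < e)"
    define U where "U = (\<Inter>t\<in>F. (\<lambda>h :: 'b \<Rightarrow> 'a. h t) -` ball (g t) e)"
    have "open U"
      unfolding U_def using F(1)
      by (intro open_INT ballI open_vimage open_ball continuous_on_product_coordinates)
    moreover have "g \<in> U" using F(2) by (simp add: U_def)
    ultimately have "eventually (\<lambda>h. h \<in> U) (nhds g)"
      by (rule eventually_nhds_in_open)
    moreover have "c n \<notin> U" if "N \<le> n" for n
      using neg that by (auto simp: U_def dist_commute)
    then have "eventually (\<lambda>h. h \<notin> U) (filtermap c sequentially)"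
      unfolding eventually_filtermap eventually_sequentially by blast
    ultimately have "eventually (\<lambda>_. False) (inf (nhds g) (filtermap c sequentially))"
      unfolding eventually_inf by blast
    then show False using g by (simp add: trivial_limit_def)
  qed
qed

lemma sum_periodic:
  fixes a :: "nat \<Rightarrow> real"
  assumes "\<And>i. a (i + n) = a i"
  shows "(\<Sum>k<i + m * n. a k) = (\<Sum>k<i. a k) + m * (\<Sum>k<n. a k)"
proof -
  have one: "(\<Sum>k<i + n. a k) = (\<Sum>k<i. a k) + (\<Sum>k<n. a k)" for i
    by (induction i) (simp_all add: assms)
  show ?thesis
  proof (induction m)
    case (Suc m)
    have "i + Suc m * n = (i + m * n) + n" by simp
    then show ?case using one[of "i + m * n"] Suc by (simp add: algebra_simps)
  qed simp
qed

context circle_class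
begin

section \<open>Cheap loops through points of the lamination\<close>

lemma tight_exists: obtains \<tau> where "tight \<phi> \<tau>"
  using Lipschitz_representative_exists tight_iff by metis

lemma tight_dist_le: "tight \<phi> \<tau> \<Longrightarrow> dist (\<tau> x) (\<tau> y) \<le> K * dist x y"
  unfolding tight_iff by (auto dest: lipschitz_onD)

lemma stretch_lamination_almost_calibrated_loop:
  assumes x: "x \<in> stretch_lamination \<phi>" and f: "f \<in> \<phi>" "modulus f \<delta>" and "0 < \<epsilon>"
  obtains L C where "chain (wt f) \<delta> x x L C" "\<delta> \<le> L" "K * L - C < \<epsilon>"
proof (rule ccontr)
  note found = that
  assume "\<not> thesis"
  then have neg: "\<epsilon> \<le> K * L - C" if "chain (wt f) \<delta> x x L C" "\<delta> \<le> L" for L C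
    using that found[of L C] by linarith
  note w = modulus_local_cocycle[OF f(2)]
  \<comment> \<open>The second bound ensures that the cost \<open>\<epsilon>\<close> of a long loop
    outweighs \<open>2 * K * dist x y\<close>.\<close>
  define r where "r = min \<delta> (\<epsilon> / (2 * K))"
  have r: "0 < r" using f(2) K_pos \<open>0 < \<epsilon>\<close> by (simp add: r_def modulus_def)
  have near: "dist x y < \<delta>" "2 * (K * dist x y) \<le> \<epsilon>" if "dist x y < r" for y
    using that K_pos by (auto simp: r_def field_simps)
  \<comment> \<open>Closing a chain between \<open>x\<close> and \<open>y\<close> by one step gives
    a loop at \<open>x\<close>. A short loop has weight 0 and the claim is the triangle inequality;
    a long one costs at least \<open>\<epsilon>\<close>.\<close>
  have loop: "K * dist x y + C' \<le> K * L" if y: "dist x y < r"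
    and c: "chain (wt f) \<delta> x x (L + dist x y) C'" and L: "dist x y \<le> L" for y L C'
  proof (cases "L + dist x y < \<delta>")
    case True
    then have "C' = 0"
      using short_chain[OF w c] local_cocycle_refl[OF w] by simp
    then show ?thesis using L K_pos by simp
  next
    case False
    then show ?thesis
      using neg[OF c] near[OF y] by (simp add: algebra_simps)
  qed
  have from_x: "potential f \<delta> x y = K * dist x y - wt f x y" if y: "dist x y < r" for y
  proof (rule antisym)
    show "potential f \<delta> x y \<le> K * dist x y - wt f x y"
      using near[OF y] by (intro potential_le[OF f] chain_single)
    show "K * dist x y - wt f x y \<le> potential f \<delta> x y"
    proof (rule potential_ge[OF f])
      fix L C assume c: "chain (wt f) \<delta> x y L C"
      have "chain (wt f) \<delta> x x (L + dist x y) (C - wt f x y)"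
        using chain.step[OF c, of x] near(1)[OF y] local_cocycle_sym[OF w near(1)[OF y]]
        by (simp add: dist_commute)
      from loop[OF y this chain_dist_le[OF c]] show "K * dist x y - wt f x y \<le> K * L - C" by simp
    qed
  qed
  have to_x: "potential f \<delta> y x = K * dist x y + wt f x y" if y: "dist x y < r" for y
  proof (rule antisym)
    show "potential f \<delta> y x \<le> K * dist x y + wt f x y"
      using potential_le[OF f chain_single[of y x]] near(1)[OF y] local_cocycle_sym[OF w near(1)[OF y]]
      by (simp add: dist_commute)
    show "K * dist x y + wt f x y \<le> potential f \<delta> y x"
    proof (rule potential_ge[OF f])
      fix L C assume c: "chain (wt f) \<delta> y x L C"
      have "chain (wt f) \<delta> x x (L + dist x y) (C + wt f x y)"
        using chain_trans[OF c chain_single[OF near(1)[OF y]]] by (simp add: add.commute)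
      from loop[OF y this] chain_dist_le[OF c] show "K * dist x y + wt f x y \<le> K * L - C"
        by (simp add: dist_commute)
    qed
  qed
  \<comment> \<open>In the mean of the two subsolutions the cones \<open>K * dist x y\<close>
    cancel. What remains near \<open>x\<close> is \<open>- wt f x y\<close>, which rotates
    \<open>f y\<close> back to \<open>f x\<close>.\<close>
  define u where "u = (\<lambda>y. (potential f \<delta> x y - potential f \<delta> y x) / 2)"
  have "subsolution f \<delta> u"
    unfolding subsolution_def
  proof (intro allI impI)
    fix y z :: 'a assume yz: "dist y z < \<delta>"
    have "potential f \<delta> x z - potential f \<delta> x y \<le> K * dist y z - wt f y z"
      "- potential f \<delta> z x - - potential f \<delta> y x \<le> K * dist y z - wt f y z"
      using subsolution_potential_from[OF f, of x] subsolution_potential_to[OF f, of x] yz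
      unfolding subsolution_def by blast+
    then show "u z - u y \<le> K * dist y z - wt f y z"
      unfolding u_def by (simp add: field_simps)
  qed
  from subsolution_lipschitz[OF f this]
  have tight: "tight \<phi> (\<lambda>p. rot (f p) (u p))" (is "tight \<phi> ?\<tau>")
    by (simp add: tight_iff)
  have "?\<tau> y = f x" if "y \<in> ball x r" for y
  proof -
    have "u y = - wt f x y" using from_x[of y] to_x[of y] that by (simp add: u_def)
    moreover have "f y = rot (f x) (wt f x y)" by (simp add: wt_def)
    ultimately show ?thesis by simp
  qed
  then have "0-lipschitz_on (ball x r) ?\<tau>"
    by (intro lipschitz_onI) auto
  then have "Lip_const (ball x r) ?\<tau> \<le> ereal 0"
    unfolding Lip_const_def by (intro INF_lower) auto
  then have "local_Lip_const ?\<tau> x \<le> 0"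
    unfolding local_Lip_const_def using r by (intro INF_lower2[of r]) (auto simp: zero_ereal_def)
  moreover have "local_Lip_const ?\<tau> x = ereal K"
    using x tight tight_Lip_const[OF tight] by (auto simp: stretch_lamination_def stretch_set_def)
  ultimately show False using K_pos by simp
qed

section \<open>Leaves as limits of almost leaves\<close>

text \<open>A \<open>K\<close>-Lipschitz map can gain \<open>K * \<bar>s - t\<bar>\<close> only over
  a distance of at least \<open>\<bar>s - t\<bar>\<close>. So the 1-Lipschitz curve is locally
  isometric, and every tight map attains its Lipschitz constant near each of its points.\<close>

lemma stretch_leafI:
  assumes lip: "\<And>s t. dist (g s) (g t) \<le> \<bar>s - t\<bar>"
    and slope: "\<And>\<tau> t. tight \<phi> \<tau> \<Longrightarrow> \<tau> (g t) = rot (\<tau> (g 0)) (K * t)"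
  shows "g \<in> stretch_leaves \<phi>"
proof -
  have dist_slope: "dist (\<tau> (g s)) (\<tau> (g t)) = K * \<bar>s - t\<bar>"
    if "tight \<phi> \<tau>" "K * \<bar>s - t\<bar> < 1/2" for \<tau> s t
  proof -
    have eq: "\<bar>K * s - K * t\<bar> = K * \<bar>s - t\<bar>"
      using K_pos by (simp add: abs_mult flip: right_diff_distrib)
    show ?thesis
      unfolding slope[OF that(1), of s] slope[OF that(1), of t]
      using dist_rot[of "K * s" "K * t"] that(2) unfolding eq by simp
  qed
  have "geodesic_line g"
    unfolding geodesic_line_def
  \<comment> \<open>At this radius the values of \<open>\<tau>\<close> rotate by less than 1/2, so
    distances in the circle are not shortened by wrapping around.\<close>
  proof (intro allI exI[of _ "1 / (4 * K)"] conjI ballI)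
    fix t s s' :: real
    assume "s \<in> ball t (1 / (4 * K))" "s' \<in> ball t (1 / (4 * K))"
    then have "\<bar>s - s'\<bar> < 2 * (1 / (4 * K))"
      by (auto simp: dist_real_def)
    then have small: "K * \<bar>s - s'\<bar> < 1/2" using K_pos by (simp add: field_simps)
    obtain \<tau> where \<tau>: "tight \<phi> \<tau>" by (rule tight_exists)
    have "K * \<bar>s - s'\<bar> \<le> K * dist (g s) (g s')"
      using tight_dist_le[OF \<tau>, of "g s" "g s'"] dist_slope[OF \<tau> small] by simp
    then show "dist (g s) (g s') = \<bar>s - s'\<bar>"
      using K_pos lip[of s s'] by simp
  qed (use K_pos in auto)
  moreover have "g t \<in> stretch_set \<tau>" if \<tau>: "tight \<phi> \<tau>" for \<tau> t
  proof -
    have "local_Lip_const \<tau> (g t) = ereal K"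
    proof (rule antisym)
      have "Lip_const (ball (g t) 1) \<tau> \<le> ereal K"
        unfolding Lip_const_def using \<tau>[unfolded tight_iff]
        by (intro INF_lower) (auto elim: lipschitz_on_subset)
      then show "local_Lip_const \<tau> (g t) \<le> ereal K"
        unfolding local_Lip_const_def by (intro INF_lower2[of 1]) auto
      show "ereal K \<le> local_Lip_const \<tau> (g t)"
        unfolding local_Lip_const_def Lip_const_def
      proof (intro INF_greatest)
        fix r B :: real assume "r \<in> {0<..}" "B \<in> {B. B-lipschitz_on (ball (g t) r) \<tau>}"
        then have r: "0 < r" and B: "B-lipschitz_on (ball (g t) r) \<tau>" by simp_all
        \<comment> \<open>Small enough to stay in the ball and to avoid wrapping around the
          circle.\<close>
        define h where "h = min (r/2) (1 / (4 * K))"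
        have h: "0 < h" "h < r" "K * h < 1/2"
        proof -
          show "0 < h" "h < r" using r K_pos by (auto simp: h_def)
          have "K * h \<le> K * (1 / (4 * K))" using K_pos by (intro mult_left_mono) (auto simp: h_def)
          then show "K * h < 1/2" using K_pos by simp
        qed
        have d: "dist (g t) (g (t + h)) \<le> h" using lip[of t "t + h"] h by simp
        have "K * h = dist (\<tau> (g t)) (\<tau> (g (t + h)))"
          using dist_slope[OF \<tau>, of t "t + h"] h by simp
        also have "\<dots> \<le> B * dist (g t) (g (t + h))"
          using B d h r by (intro lipschitz_onD[OF B]) auto
        also have "\<dots> \<le> B * h"
          using d lipschitz_on_nonneg[OF B] by (intro mult_left_mono)
        finally show "ereal K \<le> ereal B" using h by simp
      qed
    qed
    then show ?thesis
      using tight_Lip_const[OF \<tau>] by (simp add: stretch_set_def)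
  qed
  then have "range g \<subseteq> stretch_lamination \<phi>"
    unfolding stretch_lamination_def by auto
  moreover have "\<exists>a. \<forall>t. \<tau> (g t) = circle_of (a + real_of_ereal (Lip_const UNIV \<tau>) * t)"
    if \<tau>: "tight \<phi> \<tau>" for \<tau>
  proof -
    obtain a where "\<tau> (g 0) = circle_of a" by (rule circle_of_surj)
    then have "\<tau> (g t) = circle_of (a + real_of_ereal (Lip_const UNIV \<tau>) * t)" for t
      using slope[OF \<tau>, of t] by (simp add: tight_Lip_const[OF \<tau>])
    then show ?thesis by blast
  qed
  ultimately show ?thesis by (simp add: stretch_leaves_def)
qed

text \<open>The hypotheses of \<open>stretch_leafI\<close> up to an error \<open>\<eta>\<close> on a
  window of radius \<open>1/\<eta>\<close>. The additive error admits discontinuous curves, such as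
  chains read as step functions.\<close>

definition almost_leaf :: "real \<Rightarrow> (real \<Rightarrow> 'a) \<Rightarrow> bool" where
  "almost_leaf \<eta> c \<longleftrightarrow>
     (\<forall>s t. \<bar>s\<bar> \<le> 1/\<eta> \<longrightarrow> \<bar>t\<bar> \<le> 1/\<eta> \<longrightarrow> dist (c s) (c t) \<le> \<bar>s - t\<bar> + \<eta>) \<and>
     (\<forall>\<tau> t. tight \<phi> \<tau> \<longrightarrow> \<bar>t\<bar> \<le> 1/\<eta> \<longrightarrow> dist (\<tau> (c t)) (rot (\<tau> (c 0)) (K * t)) \<le> \<eta>)"

lemma almost_leaf_mono:
  assumes "almost_leaf \<eta> c" "0 < \<eta>" "\<eta> \<le> \<eta>'"
  shows "almost_leaf \<eta>' c"
proof -
  have "1/\<eta>' \<le> 1/\<eta>" using assms by (simp add: frac_le)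
  then show ?thesis
    using assms unfolding almost_leaf_def by (meson add_left_mono order_trans)
qed

text \<open>Each required relation involves at most two parameters, so closeness on finite sets
  suffices to pass to the limit.\<close>

lemma cluster_point_is_leaf:
  assumes c: "\<And>n. almost_leaf (1 / Suc n) (c n)"
    and g: "\<And>F e N. finite F \<Longrightarrow> 0 < e \<Longrightarrow> \<exists>n\<ge>N. \<forall>t\<in>F. dist (c n t) (g t) < e"
  shows "g \<in> stretch_leaves \<phi>" "dist (g s) (g t) \<le> \<bar>s - t\<bar>"
proof -
  have approx: "\<exists>n. (\<forall>t\<in>{s, t}. dist (c n t) (g t) < e) \<and> 1 / Suc n < e \<and>
      \<bar>s\<bar> \<le> real (Suc n) \<and> \<bar>t\<bar> \<le> real (Suc n)"
    if e: "0 < e" for s t e :: real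
  proof -
    obtain N :: nat where N: "1 / e < N" "\<bar>s\<bar> < N" "\<bar>t\<bar> < N"
      using reals_Archimedean2[of "max (1/e) (max \<bar>s\<bar> \<bar>t\<bar>)"] by auto
    obtain n where n: "n \<ge> N" "\<forall>t\<in>{s, t}. dist (c n t) (g t) < e"
      using g[of "{s, t}" e N] e by auto
    have "real N \<le> n" using n(1) by simp
    then have "1 / e < Suc n" "\<bar>s\<bar> \<le> Suc n" "\<bar>t\<bar> \<le> Suc n"
      using N by auto
    moreover have "1 / Suc n < e"
      using \<open>1 / e < Suc n\<close> e by (simp add: field_simps)
    ultimately show ?thesis using n(2) by blast
  qed
  have lip: "dist (g s) (g t) \<le> \<bar>s - t\<bar>" for s t
  proof (rule field_le_epsilon)
    fix e :: real assume "0 < e"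
    then obtain n where n: "\<forall>t\<in>{s, t}. dist (c n t) (g t) < e/3" "1 / Suc n < e/3"
      "\<bar>s\<bar> \<le> Suc n" "\<bar>t\<bar> \<le> Suc n"
      using approx[of "e/3" s t] by auto
    have "dist (c n s) (c n t) \<le> \<bar>s - t\<bar> + 1 / Suc n"
      using c[of n] n(3,4) unfolding almost_leaf_def by (simp del: of_nat_Suc)
    moreover have "dist (g s) (g t) \<le> dist (c n s) (g s) + dist (c n s) (c n t) + dist (c n t) (g t)"
      using dist_triangle3[of "g s" "g t" "c n s"] dist_triangle[of "c n s" "g t" "c n t"] by linarith
    moreover have "dist (c n s) (g s) < e/3" "dist (c n t) (g t) < e/3"
      using n(1) by auto
    ultimately show "dist (g s) (g t) \<le> \<bar>s - t\<bar> + e"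
      using n(2) by linarith
  qed
  have slope: "\<tau> (g t) = rot (\<tau> (g 0)) (K * t)" if \<tau>: "tight \<phi> \<tau>" for \<tau> t
  proof -
    have "dist (\<tau> (g t)) (rot (\<tau> (g 0)) (K * t)) \<le> 0"
    proof (rule field_le_epsilon)
      fix e :: real assume e: "0 < e"
      \<comment> \<open>The errors at \<open>t\<close> and at 0 contribute \<open>K * e'\<close>
        each and the defect of the almost leaf contributes \<open>e'\<close>.\<close>
      define e' where "e' = e / (2 * K + 1)"
      have "0 < e'" using e K_pos by (simp add: e'_def)
      then obtain n where n: "\<forall>t\<in>{t, 0}. dist (c n t) (g t) < e'" "1 / Suc n < e'" "\<bar>t\<bar> \<le> Suc n"
        using approx[of e' t 0] by auto
      have "dist (\<tau> (c n t)) (rot (\<tau> (c n 0)) (K * t)) \<le> 1 / Suc n"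
        using c[of n] n(3) \<tau> unfolding almost_leaf_def by (simp del: of_nat_Suc)
      moreover have "dist (\<tau> (c n s)) (\<tau> (g s)) \<le> K * e'" if "s \<in> {t, 0}" for s
      proof -
        have "dist (\<tau> (c n s)) (\<tau> (g s)) \<le> K * dist (c n s) (g s)"
          by (rule tight_dist_le[OF \<tau>])
        also have "\<dots> \<le> K * e'" using n(1) that K_pos by (intro mult_left_mono) auto
        finally show ?thesis .
      qed
      then have "dist (\<tau> (c n t)) (\<tau> (g t)) \<le> K * e'" "dist (\<tau> (c n 0)) (\<tau> (g 0)) \<le> K * e'"
        by blast+
      moreover have "dist (rot (\<tau> (c n 0)) (K * t)) (rot (\<tau> (g 0)) (K * t)) \<le> dist (\<tau> (c n 0)) (\<tau> (g 0))"
        using dist_rot_rot_le[of "\<tau> (c n 0)" "K * t" "\<tau> (g 0)" "K * t"] by simp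
      moreover have "dist (\<tau> (g t)) (rot (\<tau> (g 0)) (K * t)) \<le> dist (\<tau> (c n t)) (\<tau> (g t)) +
        dist (\<tau> (c n t)) (rot (\<tau> (c n 0)) (K * t)) +
        dist (rot (\<tau> (c n 0)) (K * t)) (rot (\<tau> (g 0)) (K * t))"
        using dist_triangle3[of "\<tau> (g t)" "rot (\<tau> (g 0)) (K * t)" "\<tau> (c n t)"]
          dist_triangle[of "\<tau> (c n t)" "rot (\<tau> (g 0)) (K * t)" "rot (\<tau> (c n 0)) (K * t)"] by linarith
      ultimately have "dist (\<tau> (g t)) (rot (\<tau> (g 0)) (K * t)) \<le> K * e' + e' + K * e'"
        using n(2) by linarith
      also have "\<dots> = (2 * K + 1) * e'" by (simp add: algebra_simps)
      also have "\<dots> = e" using K_pos by (simp add: e'_def)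
      finally show "dist (\<tau> (g t)) (rot (\<tau> (g 0)) (K * t)) \<le> 0 + e" by simp
    qed
    then show ?thesis by simp
  qed
  show "g \<in> stretch_leaves \<phi>" using lip slope by (rule stretch_leafI)
  show "dist (g s) (g t) \<le> \<bar>s - t\<bar>" by (rule lip)
qed

text \<open>Otherwise counterexamples with \<open>\<eta>\<close> tending to 0 cluster at a leaf, and
  they are uniformly close to it for some large \<open>n\<close>. The set \<open>X\<close> serves to
  prescribe the base point (a singleton) or to leave it free (\<open>UNIV\<close>).\<close>

lemma leaf_shadowing:
  assumes "closed X" "0 < \<epsilon>"
  obtains \<eta> where "0 < \<eta>" "\<And>c. almost_leaf \<eta> c \<Longrightarrow> c 0 \<in> X \<Longrightarrow>
    \<exists>g\<in>stretch_leaves \<phi>. g 0 \<in> X \<and> (\<forall>t. \<bar>t\<bar> \<le> T \<longrightarrow> dist (g t) (c t) < \<epsilon>)"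
proof (rule ccontr)
  assume neg: "\<not> thesis"
  have "\<exists>c. almost_leaf (1 / Suc n) c \<and> c 0 \<in> X \<and>
    \<not> (\<exists>g\<in>stretch_leaves \<phi>. g 0 \<in> X \<and> (\<forall>t. \<bar>t\<bar> \<le> T \<longrightarrow> dist (g t) (c t) < \<epsilon>))" for n
    using neg that[of "1 / Suc n"] by (metis of_nat_0_less_iff zero_less_Suc zero_less_divide_1_iff)
  then obtain c where c: "\<And>n. almost_leaf (1 / Suc n) (c n)" "\<And>n. c n 0 \<in> X"
    and no: "\<And>n g. g \<in> stretch_leaves \<phi> \<Longrightarrow> g 0 \<in> X \<Longrightarrow> \<exists>t. \<bar>t\<bar> \<le> T \<and> \<epsilon> \<le> dist (g t) (c n t)"
    by (metis not_le)
  obtain g where g: "\<And>F e N. finite F \<Longrightarrow> 0 < e \<Longrightarrow> \<exists>n\<ge>N. \<forall>t\<in>F. dist (c n t) (g t) < e"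
    using product_cluster_point[OF compact_UNIV, of c] by blast
  have leaf: "g \<in> stretch_leaves \<phi>" by (rule cluster_point_is_leaf(1)[OF c(1) g])
  have "\<exists>y\<in>X. dist y (g 0) < e" if "0 < e" for e
    using g[of "{0}" e 0] c(2) that by auto
  then have "g 0 \<in> X"
    using closure_approachable[of "g 0" X] assms(1) by (simp add: closure_closed)
  define h where "h = \<epsilon> / 5"
  have h: "0 < h" using assms(2) by (simp add: h_def)
  \<comment> \<open>A finite net turns closeness on finite sets into uniform closeness on the
    window, as both curves are 1-Lipschitz up to an error below \<open>h\<close>. The errors add up
    to less than \<open>4 * h\<close>.\<close>
  obtain A where A: "finite A" "{-T..T} \<subseteq> (\<Union>a\<in>A. ball a h)"
    using compact_Icc[of "-T" T] h unfolding compact_eq_totally_bounded by blast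
  obtain N :: nat where N: "1 / h < N" "T + h < N"
    using reals_Archimedean2[of "max (1/h) (T + h)"] by auto
  obtain n where n: "n \<ge> N" "\<forall>t\<in>A. dist (c n t) (g t) < h"
    using g[OF A(1) h, of N] by blast
  have Sn: "1 / Suc n < h" "T + h < Suc n"
  proof -
    have "real N \<le> n" using n(1) by simp
    then have "1 / h < Suc n" using N by simp
    then show "1 / Suc n < h" using h by (simp add: field_simps)
    show "T + h < Suc n" using \<open>real N \<le> n\<close> N by simp
  qed
  have "dist (g t) (c n t) < \<epsilon>" if t: "\<bar>t\<bar> \<le> T" for t
  proof -
    have "t \<in> {-T..T}" using t by auto
    then obtain a where a: "a \<in> A" "\<bar>a - t\<bar> < h"
      using A(2) by (auto simp: dist_real_def)
    have "\<bar>a\<bar> \<le> real (Suc n)" "\<bar>t\<bar> \<le> real (Suc n)"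
      using a(2) t Sn(2) h by linarith+
    then have "dist (c n a) (c n t) \<le> \<bar>a - t\<bar> + 1 / Suc n"
      using c(1)[of n] unfolding almost_leaf_def by (simp del: of_nat_Suc)
    moreover have "dist (g t) (g a) \<le> \<bar>a - t\<bar>"
      using cluster_point_is_leaf(2)[OF c(1) g, of t a] by (simp add: abs_minus_commute)
    moreover have "dist (c n a) (g a) < h" using n(2) a(1) by blast
    moreover have "dist (g t) (c n t) \<le> dist (g t) (g a) + dist (c n a) (g a) + dist (c n a) (c n t)"
      using dist_triangle[of "g t" "c n t" "g a"] dist_triangle3[of "g a" "c n t" "c n a"] by linarith
    ultimately have "dist (g t) (c n t) < 4 * h" using a(2) Sn(1) by linarith
    then show ?thesis using assms(2) by (simp add: h_def)
  qed
  then show False using no[OF leaf \<open>g 0 \<in> X\<close>, of n] by force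
qed


section \<open>Periodic chains as almost leaves\<close>

text \<open>Here \<open>c\<close> runs through the periodic sequence by arc length
  \<open>\<sigma>\<close>. For a tight map the cost accumulates monotonically and by at most
  \<open>\<epsilon>\<close> per period, so over a window shorter than \<open>m * \<delta>\<close>
  its slope is \<open>K\<close> up to a small error. Taking \<open>b\<close> at least
  \<open>1/\<eta>\<close> keeps the window in nonnegative time.\<close>

lemma periodic_almost_leaf:
  fixes p :: "nat \<Rightarrow> 'a" and n m :: nat and \<delta> \<epsilon> \<mu> \<eta> :: real
  assumes \<sigma>_def: "\<sigma> = (\<lambda>i. \<Sum>k<i. dist (p k) (p (Suc k)))"
    and c_def: "c = (\<lambda>t. p (LEAST i. t \<le> \<sigma> i))"
    and per: "\<And>i. p (i + n) = p i" and step: "\<And>i. dist (p i) (p (Suc i)) < \<mu>"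
    and \<delta>: "0 < \<delta>" "\<delta> \<le> \<sigma> n"
    and cost: "\<forall>\<tau>. tight \<phi> \<tau> \<longrightarrow> K * \<sigma> n - (\<Sum>k<n. wt \<tau> (p k) (p (Suc k))) \<le> \<epsilon>"
    and \<eta>: "0 < \<eta>" "2 * \<mu> \<le> \<eta>" "2 * K * \<mu> + m * \<epsilon> \<le> \<eta>" "1/\<eta> + 2 * \<mu> < m * \<delta>"
  shows "1/\<eta> \<le> b \<Longrightarrow> almost_leaf \<eta> (\<lambda>t. c (b + t))" and "c (\<sigma> i) = p i"
    and "\<sigma> (i + k * n) = \<sigma> i + k * \<sigma> n"
proof -
  have \<sigma>_per: "\<sigma> (i + k * n) = \<sigma> i + k * \<sigma> n" for i k
    unfolding \<sigma>_def by (rule sum_periodic) (metis add_Suc per)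
  then show "\<sigma> (i + k * n) = \<sigma> i + k * \<sigma> n" .
  have \<mu>: "0 < \<mu>" using step[of 0] zero_le_dist[of "p 0" "p (Suc 0)"] by linarith
  have \<sigma>_mono: "\<sigma> i \<le> \<sigma> j" if "i \<le> j" for i j
    unfolding \<sigma>_def using that by (intro sum_mono2) auto
  have \<sigma>_dist: "dist (p i) (p j) \<le> \<sigma> j - \<sigma> i" if "i \<le> j" for i j
    using that
  proof (induction j rule: dec_induct)
    case (step j)
    then show ?case
      using dist_triangle[of "p i" "p (Suc j)" "p j"] by (simp add: \<sigma>_def)
  qed simp
  then have \<sigma>_dist': "dist (p i) (p j) \<le> \<bar>\<sigma> j - \<sigma> i\<bar>" for i j
    by (metis abs_ge_self abs_minus_commute dist_commute le_cases order_trans)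
  have "\<exists>i. t \<le> \<sigma> i" for t
  proof -
    obtain k :: nat where "t / \<sigma> n < k" using reals_Archimedean2 by blast
    then have "t \<le> \<sigma> (0 + k * n)"
      using \<delta> unfolding \<sigma>_per by (simp add: \<sigma>_def field_simps)
    then show ?thesis by blast
  qed
  then have idx_ge: "t \<le> \<sigma> (LEAST i. t \<le> \<sigma> i)" for t by (rule LeastI_ex)
  \<comment> \<open>Rounding up to the next point of the sequence changes the time by at most one
    step.\<close>
  have idx: "\<bar>\<sigma> (LEAST i. t \<le> \<sigma> i) - t\<bar> \<le> \<mu>" if "0 \<le> t" for t
  proof (cases "LEAST i. t \<le> \<sigma> i")
    case 0
    then show ?thesis using idx_ge[of t] that \<mu> by (simp add: \<sigma>_def)
  next
    case (Suc i)
    then have "\<not> t \<le> \<sigma> i" by (metis lessI not_less_Least)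
    moreover have "\<sigma> (Suc i) < \<sigma> i + \<mu>" using step[of i] by (simp add: \<sigma>_def)
    ultimately show ?thesis using Suc idx_ge[of t] by simp
  qed
  show "c (\<sigma> i) = p i"
  proof -
    \<comment> \<open>Repeated points may make the least index smaller than \<open>i\<close>, but no
      length lies in between, so the point is the same.\<close>
    define j where "j = (LEAST j. \<sigma> i \<le> \<sigma> j)"
    have "j \<le> i" unfolding j_def by (rule Least_le) simp
    moreover have "\<sigma> i \<le> \<sigma> j" unfolding j_def by (rule idx_ge)
    ultimately have "dist (p j) (p i) \<le> 0" using \<sigma>_dist[of j i] by linarith
    then show ?thesis by (simp add: c_def j_def)
  qed
  show "almost_leaf \<eta> (\<lambda>t. c (b + t))" if b: "1/\<eta> \<le> b"
    unfolding almost_leaf_def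
  proof (intro conjI allI impI)
    fix s t :: real assume "\<bar>s\<bar> \<le> 1/\<eta>" "\<bar>t\<bar> \<le> 1/\<eta>"
    then have "0 \<le> b + s" "0 \<le> b + t" using b by linarith+
    from idx[OF this(1)] idx[OF this(2)]
    show "dist (c (b + s)) (c (b + t)) \<le> \<bar>s - t\<bar> + \<eta>"
      unfolding c_def using \<sigma>_dist'[of "LEAST i. b + s \<le> \<sigma> i" "LEAST i. b + t \<le> \<sigma> i"] \<eta>(2) by linarith
  next
    fix \<tau> and t :: real assume \<tau>: "tight \<phi> \<tau>" and t: "\<bar>t\<bar> \<le> 1/\<eta>"
    \<comment> \<open>\<open>W\<close> is the gain of \<open>\<tau>\<close> along the sequence and
      \<open>D\<close> the accumulated cost, whose increase measures the failure of
      \<open>\<tau>\<close> to have slope \<open>K\<close>.\<close>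
    define W where "W = (\<lambda>i. \<Sum>k<i. wt \<tau> (p k) (p (Suc k)))"
    define D where "D = (\<lambda>i. K * \<sigma> i - W i)"
    have W_rot: "\<tau> (p i) = rot (\<tau> (p 0)) (W i)" for i
    proof (induction i)
      case (Suc i)
      have "rot (\<tau> (p 0)) (W (Suc i)) = rot (rot (\<tau> (p 0)) (W i)) (wt \<tau> (p i) (p (Suc i)))"
        by (simp add: W_def)
      also have "\<dots> = \<tau> (p (Suc i))"
        unfolding Suc[symmetric] by (simp add: wt_def)
      finally show ?case ..
    qed (simp add: W_def)
    have "D i \<le> D (Suc i)" for i
    proof -
      have "wt \<tau> (p i) (p (Suc i)) \<le> K * dist (p i) (p (Suc i))"
        using tight_dist_le[OF \<tau>] abs_cdiff[of "\<tau> (p i)" "\<tau> (p (Suc i))"]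
        unfolding wt_def by (metis abs_ge_self order_trans)
      then show ?thesis by (simp add: D_def W_def \<sigma>_def distrib_left)
    qed
    then have D_mono: "D i \<le> D j" if "i \<le> j" for i j using that by (rule lift_Suc_mono_le)
    have D_per: "D (i + k * n) \<le> D i + k * \<epsilon>" for i k
    proof -
      have "W (i + k * n) = W i + k * W n"
        unfolding W_def by (rule sum_periodic) (metis add_Suc per)
      then have "D (i + k * n) = D i + k * (K * \<sigma> n - W n)"
        unfolding D_def \<sigma>_per by (simp add: algebra_simps)
      also have "\<dots> \<le> D i + k * \<epsilon>"
        using cost[rule_format, OF \<tau>] by (intro add_left_mono mult_left_mono) (auto simp: W_def)
      finally show ?thesis .
    qed
    \<comment> \<open>A period has length at least \<open>\<delta>\<close>, so \<open>j\<close> lies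
      at most \<open>m\<close> periods after \<open>i\<close>.\<close>
    have D_close: "\<bar>D j - D i\<bar> \<le> m * \<epsilon>" if "i \<le> j" "\<sigma> j - \<sigma> i < m * \<delta>" for i j
    proof -
      have "j \<le> i + m * n"
      proof (rule ccontr)
        assume "\<not> j \<le> i + m * n"
        then have "\<sigma> (i + m * n) \<le> \<sigma> j" by (intro \<sigma>_mono) simp
        moreover have "m * \<delta> \<le> m * \<sigma> n" using \<delta>(2) by (intro mult_left_mono) auto
        ultimately show False using that(2) unfolding \<sigma>_per by linarith
      qed
      then show ?thesis
        using D_mono[OF \<open>j \<le> i + m * n\<close>] D_per[of i m] D_mono[OF that(1)] by linarith
    qed
    define i where "i = (LEAST i. b \<le> \<sigma> i)"
    define j where "j = (LEAST i. b + t \<le> \<sigma> i)"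
    have "0 \<le> 1/\<eta>" using \<eta>(1) by simp
    then have "0 \<le> b" "0 \<le> b + t" using b t by linarith+
    then have ij: "\<bar>\<sigma> i - b\<bar> \<le> \<mu>" "\<bar>\<sigma> j - (b + t)\<bar> \<le> \<mu>"
      unfolding i_def j_def by (auto intro: idx)
    have "\<bar>D j - D i\<bar> \<le> m * \<epsilon>"
      using D_close[of i j] D_close[of j i] ij t \<eta>(4) by (cases "i \<le> j") linarith+
    moreover have "\<bar>K * (\<sigma> j - \<sigma> i - t)\<bar> \<le> K * (2 * \<mu>)"
      unfolding abs_mult using ij K_pos by (auto intro!: mult_left_mono)
    moreover have "W j - (W i + K * t) = K * (\<sigma> j - \<sigma> i - t) - (D j - D i)"
      by (simp add: D_def algebra_simps)
    ultimately have "\<bar>W j - (W i + K * t)\<bar> \<le> \<eta>"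
      using \<eta>(3) by linarith
    moreover have "dist (\<tau> (p j)) (rot (\<tau> (p i)) (K * t)) \<le> \<bar>W j - (W i + K * t)\<bar>"
      unfolding W_rot[of i] W_rot[of j]
      using dist_rot_rot_le[of "\<tau> (p 0)" "W j" "\<tau> (p 0)" "W i + K * t"] by simp
    ultimately show "dist (\<tau> (c (b + t))) (rot (\<tau> (c (b + 0))) (K * t)) \<le> \<eta>"
      unfolding c_def i_def j_def by simp
  qed
qed


text \<open>The weights differ by a coboundary, which telescopes to 0 around a closed chain. Hence a
  loop that is cheap for one tight map is equally cheap for all of them.\<close>

lemma closed_chain_class:
  assumes fg: "f \<in> \<phi>" "g \<in> \<phi>" and "modulus f \<delta>" "modulus g \<delta>"
    and p: "p n = p 0" "\<And>i. i < n \<Longrightarrow> dist (p i) (p (Suc i)) < \<delta>"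
  shows "(\<Sum>k<n. wt g (p k) (p (Suc k))) = (\<Sum>k<n. wt f (p k) (p (Suc k)))"
proof -
  obtain u where u: "\<And>\<delta> x y. modulus f \<delta> \<Longrightarrow> modulus g \<delta> \<Longrightarrow> dist x y < \<delta> \<Longrightarrow>
    wt g x y = wt f x y + u y - u x"
    using wt_class[OF fg] by blast
  have "(\<Sum>k<n. wt g (p k) (p (Suc k))) =
      (\<Sum>k<n. wt f (p k) (p (Suc k)) + (u (p (Suc k)) - u (p k)))"
    using u[OF assms(3,4) p(2)] by (intro sum.cong) auto
  also have "\<dots> = (\<Sum>k<n. wt f (p k) (p (Suc k)))"
    using p(1) sum_lessThan_telescope[of "\<lambda>k. u (p k)" n] by (simp add: sum.distrib)
  finally show ?thesis .
qed

text \<open>One modulus for all tight maps makes the estimates uniform in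
  \<open>\<tau>\<close>.\<close>

lemma tight_modulus: "tight \<phi> \<tau> \<Longrightarrow> modulus \<tau> (1 / (4 * K))"
  unfolding modulus_def
proof (intro conjI allI impI)
  fix x y :: 'a assume \<tau>: "tight \<phi> \<tau>" and "dist x y < 1 / (4 * K)"
  then have "K * dist x y < 1/4" using K_pos by (simp add: field_simps)
  then show "dist (\<tau> x) (\<tau> y) < 1/4" using tight_dist_le[OF \<tau>, of x y] by linarith
qed (use K_pos in simp)

lemma lamination_periodic_sequence:
  fixes x :: 'a
  assumes x: "x \<in> stretch_lamination \<phi>" and "0 < \<epsilon>" "0 < \<mu>" "\<mu> \<le> 1 / (4 * K)"
  defines "\<delta> \<equiv> 1 / (4 * K)"
  obtains p :: "nat \<Rightarrow> 'a" and n where "p 0 = x" "\<And>i. p (i + n) = p i"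
    "\<And>i. dist (p i) (p (Suc i)) < \<mu>" "\<delta> \<le> (\<Sum>k<n. dist (p k) (p (Suc k)))"
    "\<forall>\<tau>. tight \<phi> \<tau> \<longrightarrow> K * (\<Sum>k<n. dist (p k) (p (Suc k))) - (\<Sum>k<n. wt \<tau> (p k) (p (Suc k))) \<le> \<epsilon>"
proof -
  have \<delta>: "0 < \<delta>" using K_pos by (simp add: \<delta>_def)
  obtain f where f: "tight \<phi> f" by (rule tight_exists)
  have f': "f \<in> \<phi>" "modulus f \<delta>" using f tight_modulus[OF f] by (auto simp: tight_iff \<delta>_def)
  obtain L C where c: "chain (wt f) \<delta> x x L C" "\<delta> \<le> L" "K * L - C < \<epsilon>/2"
    using stretch_lamination_almost_calibrated_loop[OF x f', of "\<epsilon>/2"] \<open>0 < \<epsilon>\<close> by auto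
  \<comment> \<open>Additional length below \<open>\<epsilon> / (2 * K)\<close> costs less than
    \<open>\<epsilon>/2\<close>, the other half of the budget.\<close>
  have "0 < \<epsilon> / (2 * K)" using \<open>0 < \<epsilon>\<close> K_pos by simp
  from refine_chain[OF modulus_local_cocycle[OF f'(2)] \<open>0 < \<mu>\<close> c(1) this]
  obtain L' where L': "L \<le> L'" "L' < L + \<epsilon> / (2 * K)" "chain (wt f) \<mu> x x L' C" by blast
  have "K * L' \<le> K * (L + \<epsilon> / (2 * K))" using L'(2) K_pos by (intro mult_left_mono) auto
  also have "\<dots> = K * L + \<epsilon>/2" using K_pos by (simp add: field_simps)
  finally have cost: "K * L' - C \<le> \<epsilon>" using c(3) by linarith
  obtain n q where q: "q 0 = x" "q n = x" "\<And>i. i < n \<Longrightarrow> dist (q i) (q (Suc i)) < \<mu>"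
    "L' = (\<Sum>i<n. dist (q i) (q (Suc i)))" "C = (\<Sum>i<n. wt f (q i) (q (Suc i)))"
    using sequence_of_chain[OF L'(3)] by metis
  \<comment> \<open>The length is at least \<open>\<delta>\<close>, which rules out the empty chain
    and makes reduction modulo \<open>n\<close> meaningful.\<close>
  have n: "0 < n"
    using q(4) c(2) L'(1) \<delta> by (cases n) auto
  define p where "p = (\<lambda>i. q (i mod n))"
  have p_Suc: "p (Suc i) = q (Suc (i mod n))" for i
    using n q(1,2) by (simp add: p_def mod_Suc)
  have p_le: "p i = q i" if "i < n" for i using that by (simp add: p_def)
  have sums: "(\<Sum>k<n. h (p k) (p (Suc k))) = (\<Sum>k<n. h (q k) (q (Suc k)))" for h :: "'a \<Rightarrow> 'a \<Rightarrow> real"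
    by (intro sum.cong) (auto simp: p_Suc p_le)
  show ?thesis
  proof (rule that[of p n])
    show "p 0 = x" "p (i + n) = p i" for i using q(1) by (simp_all add: p_def)
    show "dist (p i) (p (Suc i)) < \<mu>" for i
      using q(3)[of "i mod n"] n unfolding p_Suc by (simp add: p_def)
    show "\<delta> \<le> (\<Sum>k<n. dist (p k) (p (Suc k)))"
      unfolding sums using c(2) L'(1) q(4) by simp
    show "\<forall>\<tau>. tight \<phi> \<tau> \<longrightarrow>
      K * (\<Sum>k<n. dist (p k) (p (Suc k))) - (\<Sum>k<n. wt \<tau> (p k) (p (Suc k))) \<le> \<epsilon>"
    proof (intro allI impI)
      fix \<tau> assume \<tau>: "tight \<phi> \<tau>"
      have "(\<Sum>k<n. wt \<tau> (q k) (q (Suc k))) = (\<Sum>k<n. wt f (q k) (q (Suc k)))"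
      proof (rule closed_chain_class[OF f'(1) _ f'(2)])
        show "\<tau> \<in> \<phi>" "modulus \<tau> \<delta>"
          using \<tau> tight_modulus[OF \<tau>] by (auto simp: tight_iff \<delta>_def)
        show "dist (q i) (q (Suc i)) < \<delta>" if "i < n" for i
          using q(3)[OF that] assms(4) by (simp add: \<delta>_def)
      qed (use q in simp)
      then show "K * (\<Sum>k<n. dist (p k) (p (Suc k))) - (\<Sum>k<n. wt \<tau> (p k) (p (Suc k))) \<le> \<epsilon>"
      unfolding sums using cost q(4,5) by simp
    qed
  qed
qed

lemma lamination_almost_leaf_loop:
  assumes x: "x \<in> stretch_lamination \<phi>" and \<eta>: "0 < \<eta>"
  obtains c B L where "1 / (4 * K) \<le> L" "c B = x" "c (B + L) = x"
    "\<forall>b\<ge>B. almost_leaf \<eta> (\<lambda>t. c (b + t))"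
proof -
  define \<delta> where "\<delta> = 1 / (4 * K)"
  have \<delta>: "0 < \<delta>" using K_pos by (simp add: \<delta>_def)
  \<comment> \<open>The number of periods is fixed by the window alone, before the loop is chosen;
    the allowed cost per period can then be \<open>\<eta> / (2 * m)\<close>. The error from the step
    size takes the other half of \<open>\<eta>\<close>.\<close>
  obtain m :: nat where m: "(1/\<eta> + \<eta>) / \<delta> < m" using reals_Archimedean2 by blast
  then have m': "1/\<eta> + \<eta> < m * \<delta>" using \<delta> by (simp add: field_simps)
  have m0: "0 < real m"
    using m \<eta> \<delta> by (smt (verit) divide_pos_pos zero_less_one)
  define \<mu> where "\<mu> = min \<delta> (min (\<eta>/2) (\<eta> / (4 * K)))"
  have "0 < \<mu>" "\<mu> \<le> \<delta>" "2 * \<mu> \<le> \<eta>" "\<mu> \<le> \<eta> / (4 * K)"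
    using \<delta> \<eta> K_pos by (auto simp: \<mu>_def)
  moreover have "2 * K * \<mu> \<le> \<eta>/2"
    using \<open>\<mu> \<le> \<eta> / (4 * K)\<close> K_pos by (simp add: field_simps)
  ultimately have \<mu>: "0 < \<mu>" "\<mu> \<le> 1 / (4 * K)" "2 * \<mu> \<le> \<eta>" "2 * K * \<mu> + m * (\<eta> / (2 * m)) \<le> \<eta>"
    using m0 by (auto simp: \<delta>_def)
  have "0 < \<eta> / (2 * m)" using \<eta> m0 by simp
  from lamination_periodic_sequence[OF x this \<mu>(1,2)]
  obtain p :: "nat \<Rightarrow> 'a" and n where p: "p 0 = x" "\<And>i. p (i + n) = p i"
    "\<And>i. dist (p i) (p (Suc i)) < \<mu>" "\<delta> \<le> (\<Sum>k<n. dist (p k) (p (Suc k)))"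
    "\<forall>\<tau>. tight \<phi> \<tau> \<longrightarrow> K * (\<Sum>k<n. dist (p k) (p (Suc k))) - (\<Sum>k<n. wt \<tau> (p k) (p (Suc k))) \<le> \<eta> / (2 * m)"
    unfolding \<delta>_def by blast
  define \<sigma> where "\<sigma> = (\<lambda>i. \<Sum>k<i. dist (p k) (p (Suc k)))"
  define c where "c = (\<lambda>t. p (LEAST i. t \<le> \<sigma> i))"
  have \<sigma>_n: "\<sigma> n = (\<Sum>k<n. dist (p k) (p (Suc k)))" by (simp add: \<sigma>_def)
  have "1/\<eta> + 2 * \<mu> < m * \<delta>" using m' \<mu>(3) by linarith
  note * = periodic_almost_leaf[OF \<sigma>_def c_def p(2,3) \<delta> p(4,5)[folded \<sigma>_n] \<eta> \<mu>(3,4) this]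
  have per: "p (k * n) = x" for k
    by (induction k) (simp_all add: p(1,2) add.commute[of n])
  \<comment> \<open>Starting after \<open>k\<close> full periods leaves a window of radius
    \<open>1/\<eta>\<close> to the left of the base time.\<close>
  obtain k :: nat where k: "1/\<eta> / \<delta> < k" using reals_Archimedean2 by blast
  have "1/\<eta> < k * \<delta>" using k by (simp only: pos_divide_less_eq[OF \<delta>])
  also have "\<dots> \<le> k * \<sigma> n" using p(4) by (intro mult_left_mono) (auto simp: \<sigma>_def)
  also have "\<dots> = \<sigma> (k * n)" using *(3)[of 0 k] by (simp add: \<sigma>_def)
  finally have B: "1/\<eta> \<le> \<sigma> (k * n)" by simp
  show ?thesis
  proof (rule that[of "\<sigma> n" c "\<sigma> (k * n)"])
    show "1 / (4 * K) \<le> \<sigma> n" using p(4) by (simp add: \<sigma>_def \<delta>_def)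
    show "c (\<sigma> (k * n)) = x" using *(2)[of "k * n"] per by simp
    have "\<sigma> (k * n) + \<sigma> n = \<sigma> (k * n + 1 * n)" unfolding *(3) by simp
    then show "c (\<sigma> (k * n) + \<sigma> n) = x"
      using *(2)[of "k * n + 1 * n"] p(2)[of "k * n"] per by simp
    show "\<forall>b\<ge>\<sigma> (k * n). almost_leaf \<eta> (\<lambda>t. c (b + t))"
      using B by (intro allI impI *(1)) simp
  qed
qed

section \<open>Assembly of the chain of leaf segments\<close>

theorem stretch_lamination_chain_recurrent:
  "chain_recurrent (stretch_lamination \<phi>) (stretch_leaves \<phi>)"
  unfolding chain_recurrent_def chain_recurrent_point_def
proof (intro ballI exI[of _ "1 / (8 * K)"] conjI allI impI)
  fix x assume x: "x \<in> stretch_lamination \<phi>"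
  define a where "a = 1 / (8 * K)"
  show "0 < 1 / (8 * K)" using K_pos by simp
  then have a: "0 < a" by (simp add: a_def)
  fix \<epsilon> :: real assume \<epsilon>: "0 < \<epsilon>"
  \<comment> \<open>A third rather than a half: the supremum in \<open>tangent_dist\<close> is only
    bounded weakly by \<open>2 * \<epsilon>'\<close>, which must lie strictly below
    \<open>\<epsilon>\<close>.\<close>
  define \<epsilon>' where "\<epsilon>' = \<epsilon> / 3"
  have \<epsilon>': "0 < \<epsilon>'" using \<epsilon> by (simp add: \<epsilon>'_def)
  \<comment> \<open>Room for a piece of length at most \<open>2 * a\<close> and for the unit of time
    seen by \<open>tangent_dist\<close>. It is fixed before the loop, whose length \<open>L\<close>
    is not bounded above.\<close>
  define T where "T = 2 * a + 1"
  obtain \<eta>1 where \<eta>1: "0 < \<eta>1" "\<And>c. almost_leaf \<eta>1 c \<Longrightarrow> c 0 \<in> {x} \<Longrightarrow>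
    \<exists>g\<in>stretch_leaves \<phi>. g 0 \<in> {x} \<and> (\<forall>t. \<bar>t\<bar> \<le> T \<longrightarrow> dist (g t) (c t) < \<epsilon>')"
    using leaf_shadowing[of "{x}" \<epsilon>' T] \<epsilon>' by blast
  obtain \<eta>2 where \<eta>2: "0 < \<eta>2" "\<And>c. almost_leaf \<eta>2 c \<Longrightarrow> c 0 \<in> UNIV \<Longrightarrow>
    \<exists>g\<in>stretch_leaves \<phi>. g 0 \<in> UNIV \<and> (\<forall>t. \<bar>t\<bar> \<le> T \<longrightarrow> dist (g t) (c t) < \<epsilon>')"
    using leaf_shadowing[of UNIV \<epsilon>' T] \<epsilon>' by blast
  define \<eta> where "\<eta> = min \<eta>1 \<eta>2"
  have \<eta>: "0 < \<eta>" "\<eta> \<le> \<eta>1" "\<eta> \<le> \<eta>2" using \<eta>1(1) \<eta>2(1) by (auto simp: \<eta>_def)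
  obtain c B L where L: "1 / (4 * K) \<le> L" and cx: "c B = x" "c (B + L) = x"
    and c: "\<forall>b\<ge>B. almost_leaf \<eta> (\<lambda>t. c (b + t))"
    by (rule lamination_almost_leaf_loop[OF x \<eta>(1)])
  have L2: "2 * a \<le> L" using L by (simp add: a_def)
  \<comment> \<open>Cutting the loop into this many equal pieces gives lengths \<open>h\<close>
    between \<open>a\<close> and \<open>2 * a\<close>.\<close>
  define N where "N = nat \<lfloor>L / a\<rfloor>"
  have "2 \<le> L / a" using L2 a by (simp add: field_simps)
  then have N: "2 \<le> N" "real N \<le> L / a" "L / a < real N + 1"
    unfolding N_def by linarith+
  define h where "h = L / N"
  have hN: "N * h = L" using N(1) by (simp add: h_def)
  have "a \<le> h" using N a by (simp add: h_def field_simps)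
  have "L < (real N + 1) * a" using N(3) a by (simp add: field_simps)
  also have "\<dots> \<le> (2 * real N) * a" using N(1) a by (intro mult_right_mono) auto
  finally have "h \<le> 2 * a" using N(1) by (simp add: h_def field_simps)
  then have hT: "h + 1 \<le> T" by (simp add: T_def)
  \<comment> \<open>The leaves shadowing the loop at its initial and final times are taken with
    \<open>X = {x}\<close>, so they pass through \<open>x\<close> itself.\<close>
  have "\<forall>i::nat. \<exists>g. g \<in> stretch_leaves \<phi> \<and>
      (\<forall>t. \<bar>t\<bar> \<le> T \<longrightarrow> dist (g t) (c (B + real i * h + t)) < \<epsilon>') \<and> (i = 0 \<or> i = N \<longrightarrow> g 0 = x)"
  proof (rule allI)
    fix i :: nat
    have "B \<le> B + real i * h" using \<open>a \<le> h\<close> a by simp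
    note al = c[rule_format, OF this]
    show "\<exists>g. g \<in> stretch_leaves \<phi> \<and>
      (\<forall>t. \<bar>t\<bar> \<le> T \<longrightarrow> dist (g t) (c (B + real i * h + t)) < \<epsilon>') \<and> (i = 0 \<or> i = N \<longrightarrow> g 0 = x)"
    proof (cases "i = 0 \<or> i = N")
      case True
      then have "c (B + real i * h + 0) \<in> {x}" using cx hN by auto
      from \<eta>1(2)[OF almost_leaf_mono[OF al \<eta>(1,2)] this] show ?thesis by auto
    next
      case False
      from \<eta>2(2)[OF almost_leaf_mono[OF al \<eta>(1,3)]] False show ?thesis by auto
    qed
  qed
  from choice[OF this] obtain g where g: "\<And>i::nat. g i \<in> stretch_leaves \<phi>"
    "\<And>i t. \<bar>t\<bar> \<le> T \<Longrightarrow> dist (g i t) (c (B + real i * h + t)) < \<epsilon>'" "g 0 0 = x" "g N 0 = x"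
    by blast
  define k where "k = N - 1"
  have k: "0 < k" "N = Suc k" using N(1) by (auto simp: k_def)
  \<comment> \<open>The last segment is followed backwards from \<open>B + L\<close>, so that it ends exactly at \<open>x\<close>.\<close>
  define \<gamma> where "\<gamma> = (\<lambda>i. if i < k then g i else g N)"
  define s where "s = (\<lambda>i. if i < k then 0 else - h)"
  define t where "t = (\<lambda>i. if i < k then h else 0)"
  have start: "dist (\<gamma> i (s i + r)) (c (B + i * h + r)) < \<epsilon>'" if "i \<le> k" "0 \<le> r" "r \<le> 1" for i r
  proof (cases "i < k")
    case True
    then show ?thesis using g(2)[of r i] that hT \<open>a \<le> h\<close> a by (simp add: \<gamma>_def s_def)
  next
    case False
    then have "i = k" using that by simp
    have eq: "B + real k * h + r = B + real N * h + (- h + r)" by (simp add: k(2) algebra_simps)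
    have "\<bar>- h + r\<bar> \<le> T" using that hT \<open>a \<le> h\<close> a by linarith
    then have "dist (g N (- h + r)) (c (B + real k * h + r)) < \<epsilon>'"
      unfolding eq by (rule g(2))
    then show ?thesis using \<open>i = k\<close> by (simp add: \<gamma>_def s_def)
  qed
  have finish: "dist (\<gamma> i (t i + r)) (c (B + Suc i * h + r)) < \<epsilon>'" if "i < k" "0 \<le> r" "r \<le> 1" for i r
  proof -
    have eq: "B + Suc i * h + r = B + real i * h + (h + r)" by (simp add: algebra_simps)
    have "\<bar>h + r\<bar> \<le> T" using that hT \<open>a \<le> h\<close> a by linarith
    then have "dist (g i (h + r)) (c (B + Suc i * h + r)) < \<epsilon>'"
      unfolding eq by (rule g(2))
    then show ?thesis using that by (simp add: \<gamma>_def t_def)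
  qed
  show "leaf_chain (stretch_leaves \<phi>) (1 / (8 * K)) \<epsilon> x x"
    unfolding leaf_chain_def a_def[symmetric]
  proof (rule exI[of _ k], rule exI[of _ \<gamma>], rule exI[of _ s], rule exI[of _ t], intro conjI allI impI)
    show "\<gamma> i \<in> stretch_leaves \<phi>" "a \<le> t i - s i" for i
      using g(1) \<open>a \<le> h\<close> by (auto simp: \<gamma>_def s_def t_def)
    show "\<gamma> 0 (s 0) = x" "\<gamma> k (t k) = x"
      using k g(3,4) by (auto simp: \<gamma>_def s_def t_def)
    fix i assume i: "i < k"
    have "tangent_dist (tangent_at (\<gamma> i) (t i)) (tangent_at (\<gamma> (Suc i)) (s (Suc i))) \<le> 2 * \<epsilon>'"
      unfolding tangent_dist_def tangent_at_def
    proof (rule cSUP_least)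
      fix r :: real assume "r \<in> {0..1}"
      then show "dist (\<gamma> i (t i + r)) (\<gamma> (Suc i) (s (Suc i) + r)) \<le> 2 * \<epsilon>'"
        using finish[OF i, of r] start[of "Suc i" r] i
          dist_triangle2[of "\<gamma> i (t i + r)" "\<gamma> (Suc i) (s (Suc i) + r)" "c (B + Suc i * h + r)"]
        by auto
    qed simp
    also have "\<dots> < \<epsilon>" using \<epsilon> by (simp add: \<epsilon>'_def)
    finally show "tangent_dist (tangent_at (\<gamma> i) (t i)) (tangent_at (\<gamma> (Suc i)) (s (Suc i))) < \<epsilon>" .
  qed
qed

end

theorem theorem1p12:
  fixes \<phi> :: "('a::metric_space \<Rightarrow> circle) set"
  assumes "closed_hyperbolic_manifold TYPE('m::finite) TYPE('a)"
    and "homotopy_class \<phi>"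
    and "nontrivial_class \<phi>"
  shows "chain_recurrent (stretch_lamination \<phi>) (stretch_leaves \<phi>)"
proof -
  interpret circle_class "TYPE('a)" \<phi>
    using assms unfolding closed_hyperbolic_manifold_def by unfold_locales auto
  show ?thesis by (rule stretch_lamination_chain_recurrent)
qed

end
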